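(* The second Nash blow-up algebra of a hypersurface with an isolated singularity is a contact invariant. That is: let $F$ be a holomorphic function germ of $n$ variables at $0\in\mathbb{C}^n$ defining a hypersurface with an isolated singularity at $0$, let $u\in\mathcal{O}_n$ be a unit, let $\phi:(\mathbb{C}^n,0)\to(\mathbb{C}^n,0)$ be an isomorphic (biholomorphic) germ, and let $G=u\cdot(F\circ\phi)$. Then the $\mathbb{C}$-algebras \[\mathcal{O}_n/(F,\mathcal{J}_2(F))\quad\text{and}\quad \mathcal{O}_n/(G,\mathcal{J}_2(G))\] are isomorphic.
   Context: $\mathcal{O}_n=\mathbb{C}\{z_1,\dots,z_n\}$ is the algebra of germs of holomorphic functions at the origin of $\mathbb{C}^n$. For a germ $F\in\mathcal{O}_n$ write $f_k=\partial F/\partial z_k$ and $f_{ij}=\partial^2F/\partial z_i\partial z_j$. The second Jacobian matrix $\mathrm{Jac}_2(F)$ is the $(n+1)\times\left(n+\binom{n+1}{2}\right)$ matrix with rows labeled $\beta_0,\beta_1,\dots,\beta_n$ and columns labeled $\beta_{ij}$ for $0\le i\le j\le n$, $(i,j)\ne(0,0)$, ordered as $\beta_{01},\dots,\beta_{0n},\beta_{11},\dots,\beta_{1n},\beta_{22},\dots,\beta_{(n-1)n},\beta_{nn}$. Its entries are as follows. Row $\beta_0$: the entry in column $\beta_{0j}$ is $f_j$, in column $\beta_{ii}$ ($i\ge1$) is $\frac12 f_{ii}$, and in column $\beta_{ij}$ ($1\le i<j$) is $f_{ij}$. Row $\beta_k$ with $k\ge1$: the entry in column $\beta_{0j}$ is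 $0$; the entry in column $\beta_{ij}$ ($1\le i\le j$) is $f_j$ if $k=i$, is $f_i$ if $k=j$, and is $0$ otherwise. The second Jacobian ideal $\mathcal{J}_2(F)\subseteq\mathcal{O}_n$ is the ideal generated by the maximal minors of $\mathrm{Jac}_2(F)$. For $F$ with an isolated singularity at $0$, the second Nash blow-up local algebra of $V=V(F)$ is $\mathcal{M}_2(V)=\mathcal{O}_n/(F,\mathcal{J}_2(F))$. Two germs $F,G$ are contact equivalent if $G=u\cdot(F\circ\phi)$ for a unit $u$ and a biholomorphic germ $\phi$ fixing the origin; a contact invariant is an algebra whose isomorphism class depends only on the contact equivalence class. *)

theory Defs
  imports
    "HOL-Complex_Analysis.Complex_Analysis"
    "HOL-Algebra.QuotRing"
    "HOL-Algebra.Module"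
    "HOL-Library.Option_ord"
begin

unbundle no Formal_Power_Series.fps_syntax

section \<open>Holomorphic functions of several variables near the origin\<close>

text \<open>
  \<^prop>\<open>cdiff f z\<close>: the Frechet derivative of \<^term>\<open>f\<close> at \<^term>\<open>z\<close> exists and is complex linear.
\<close>

definition cdiff :: "(complex ^ 'n \<Rightarrow> complex) \<Rightarrow> complex ^ 'n \<Rightarrow> bool" where
  "cdiff f z \<longleftrightarrow> (\<exists>D. (f has_derivative D) (at z) \<and> (\<forall>c v. D (c *s v) = c * D v))"

definition holo_near_0 :: "(complex ^ 'n \<Rightarrow> complex) \<Rightarrow> bool" where
  "holo_near_0 f \<longleftrightarrow> (\<forall>\<^sub>F z in nhds 0. cdiff f z)"

definition cpartial :: "'n \<Rightarrow> (complex ^ 'n \<Rightarrow> complex) \<Rightarrow> complex ^ 'n \<Rightarrow> complex" where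
  "cpartial k f z = deriv (\<lambda>t. f (z + axis k t)) 0"

lemma cdiff_const: "cdiff (\<lambda>_. c) z"
  unfolding cdiff_def by (rule exI[of _ "\<lambda>_. 0"]) auto

lemma cdiff_add: "cdiff f z \<Longrightarrow> cdiff g z \<Longrightarrow> cdiff (\<lambda>z. f z + g z) z"
  unfolding cdiff_def
proof (elim exE conjE)
  fix D E assume "(f has_derivative D) (at z)" "(g has_derivative E) (at z)"
    "\<forall>c v. D (c *s v) = c * D v" "\<forall>c v. E (c *s v) = c * E v"
  then show "\<exists>D. ((\<lambda>z. f z + g z) has_derivative D) (at z) \<and> (\<forall>c v. D (c *s v) = c * D v)"
    by (intro exI[of _ "\<lambda>v. D v + E v"]) (auto intro!: has_derivative_add simp: distrib_left)
qed

lemma cdiff_minus: "cdiff f z \<Longrightarrow> cdiff (\<lambda>z. - f z) z"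
  unfolding cdiff_def
proof (elim exE conjE)
  fix D assume "(f has_derivative D) (at z)" "\<forall>c v. D (c *s v) = c * D v"
  then show "\<exists>D. ((\<lambda>z. - f z) has_derivative D) (at z) \<and> (\<forall>c v. D (c *s v) = c * D v)"
    by (intro exI[of _ "\<lambda>v. - D v"]) (auto intro!: has_derivative_minus)
qed

lemma cdiff_mult: "cdiff f z \<Longrightarrow> cdiff g z \<Longrightarrow> cdiff (\<lambda>z. f z * g z) z"
  unfolding cdiff_def
proof (elim exE conjE)
  fix D E assume "(f has_derivative D) (at z)" "(g has_derivative E) (at z)"
    "\<forall>c v. D (c *s v) = c * D v" "\<forall>c v. E (c *s v) = c * E v"
  then show "\<exists>D. ((\<lambda>z. f z * g z) has_derivative D) (at z) \<and> (\<forall>c v. D (c *s v) = c * D v)"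
    by (intro exI[of _ "\<lambda>v. f z * E v + D v * g z"])
       (simp add: has_derivative_mult distrib_left mult.left_commute mult.assoc)
qed

lemma cdiff_nth: "cdiff (\<lambda>z. z $ i) z"
  unfolding cdiff_def
  by (rule exI[of _ "\<lambda>v. v $ i"])
     (auto intro!: bounded_linear_imp_has_derivative bounded_linear_vec_nth)

lemma vec_nth_cdiff_has_derivative:
  fixes \<phi> :: "complex ^ 'n \<Rightarrow> complex ^ 'm"
  assumes "\<And>i. cdiff (\<lambda>z. \<phi> z $ i) z"
  shows "\<exists>D. (\<phi> has_derivative D) (at z) \<and> (\<forall>c v. D (c *s v) = c *s D v)"
proof -
  from assms obtain D where D: "\<And>i. ((\<lambda>z. \<phi> z $ i) has_derivative D i) (at z)"
    "\<And>i c v. D i (c *s v) = c * D i v"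
    unfolding cdiff_def by metis
  have "(\<phi> has_derivative (\<lambda>v. \<chi> i. D i v)) (at z)"
  proof (subst has_derivative_componentwise_within, intro ballI)
    fix b :: "complex ^ 'm" assume "b \<in> Basis"
    then obtain i u where b: "b = axis i u" by (auto simp: Basis_vec_def)
    show "((\<lambda>x. \<phi> x \<bullet> b) has_derivative (\<lambda>x. (\<chi> i. D i x) \<bullet> b)) (at z)"
      unfolding b inner_axis by (auto intro!: has_derivative_inner_left D(1))
  qed
  then show ?thesis using D(2)
    by (intro exI[of _ "\<lambda>v. \<chi> i. D i v"]) (auto simp: vec_eq_iff)
qed

lemma cdiff_compose:
  fixes \<phi> :: "complex ^ 'n \<Rightarrow> complex ^ 'm"
  assumes "cdiff f (\<phi> z)" "\<And>i. cdiff (\<lambda>z. \<phi> z $ i) z"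
  shows "cdiff (\<lambda>z. f (\<phi> z)) z"
proof -
  from vec_nth_cdiff_has_derivative[OF assms(2)] obtain D
    where D: "(\<phi> has_derivative D) (at z)" "\<forall>c v. D (c *s v) = c *s D v" by blast
  from assms(1) obtain E
    where E: "(f has_derivative E) (at (\<phi> z))" "\<forall>c v. E (c *s v) = c * E v"
    unfolding cdiff_def by blast
  from diff_chain_at[OF D(1) E(1)] D(2) E(2) show ?thesis
    unfolding cdiff_def by (intro exI[of _ "E \<circ> D"]) (auto simp: o_def)
qed

lemma axis_eq_scale: "axis k (t::complex) = t *s axis k 1"
  by (simp add: vec_eq_iff axis_def)

lemma norm_axis_complex: "norm (axis k t) = norm (t::complex)"
proof -
  have "(\<Sum>i\<in>UNIV. (norm (axis k t $ i))\<^sup>2) = (\<Sum>i\<in>UNIV. if i = k then (norm t)\<^sup>2 else 0)"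
    by (rule sum.cong) (auto simp: axis_def)
  then show ?thesis by (simp add: norm_vec_def L2_set_def)
qed

lemma bounded_linear_axis_complex: "bounded_linear (\<lambda>t::complex. axis k t)"
  by (rule bounded_linear_intro[of _ 1])
     (auto simp: vec_eq_iff axis_def norm_axis_complex[unfolded axis_def])

lemma cdiff_cpartial:
  fixes f :: "complex ^ 'n \<Rightarrow> complex"
  assumes "cdiff f z"
  shows "((\<lambda>t. f (z + axis k t)) has_field_derivative cpartial k f z) (at 0)"
    and "(f has_derivative (\<lambda>v. \<Sum>i\<in>UNIV. v $ i * cpartial i f z)) (at z)"
proof -
  from assms obtain D where D: "(f has_derivative D) (at z)" "\<And>c v. D (c *s v) = c * D v"
    unfolding cdiff_def by blast
  have *: "((\<lambda>t. f (z + axis k t)) has_field_derivative D (axis k 1)) (at 0)" for k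
  proof -
    have 1: "((\<lambda>t::complex. z + axis k t) has_derivative (\<lambda>t. axis k t)) (at 0)"
      using has_derivative_add[OF has_derivative_const
        bounded_linear_imp_has_derivative[OF bounded_linear_axis_complex]] by force
    have 0: "axis k 0 = (0 :: complex ^ 'n)" by (simp add: vec_eq_iff axis_def)
    have "((\<lambda>t. f (z + axis k t)) has_derivative (\<lambda>t. D (axis k t))) (at 0)"
      using diff_chain_at[OF 1, of f D] D(1) by (simp add: o_def 0)
    moreover have "(\<lambda>t. D (axis k t)) = (*) (D (axis k 1))"
    proof
      fix t
      show "D (axis k t) = D (axis k 1) * t"
        unfolding axis_eq_scale[of k t] D(2) by (rule mult.commute)
    qed
    ultimately show ?thesis unfolding has_field_derivative_def by metis
  qed
  then have eq: "cpartial k f z = D (axis k 1)" for k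
    unfolding cpartial_def by (rule DERIV_imp_deriv)
  show "((\<lambda>t. f (z + axis k t)) has_field_derivative cpartial k f z) (at 0)"
    using * eq by simp
  have "D v = (\<Sum>i\<in>UNIV. v $ i * cpartial i f z)" for v
  proof -
    have "v = (\<Sum>i\<in>UNIV. (v $ i) *s axis i 1)"
      by (rule basis_expansion[symmetric])
    then have "D v = D (\<Sum>i\<in>UNIV. (v $ i) *s axis i 1)" by simp
    also have "\<dots> = (\<Sum>i\<in>UNIV. D ((v $ i) *s axis i 1))"
      by (rule linear_sum[OF has_derivative_linear[OF D(1)]])
    finally show ?thesis by (simp add: D(2) eq)
  qed
  then have "D = (\<lambda>v. \<Sum>i\<in>UNIV. v $ i * cpartial i f z)" by auto
  with D(1) show "(f has_derivative (\<lambda>v. \<Sum>i\<in>UNIV. v $ i * cpartial i f z)) (at z)" by simp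
qed

lemma cdiff_isCont: "cdiff f z \<Longrightarrow> isCont f z"
  unfolding cdiff_def using has_derivative_continuous by blast

lemma cdiff_slice:
  fixes f :: "complex ^ 'n \<Rightarrow> complex"
  assumes "cdiff f (z + axis k t)"
  shows "((\<lambda>t. f (z + axis k t)) has_field_derivative cpartial k f (z + axis k t)) (at t)"
proof -
  have "axis k (s + t) = axis k s + axis k t" for s :: complex
    by (simp add: vec_eq_iff axis_def)
  then have "((\<lambda>s. f (z + axis k (s + t))) has_field_derivative cpartial k f (z + axis k t)) (at 0)"
    using cdiff_cpartial(1)[OF assms, of k] by (simp add: ac_simps)
  then show ?thesis using DERIV_shift[of "\<lambda>t. f (z + axis k t)" _ 0 t] by simp
qed

lemma cpartial_cauchy:
  fixes f :: "complex ^ 'n \<Rightarrow> complex"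
  assumes cd: "\<And>z. z \<in> ball 0 (2 * r) \<Longrightarrow> cdiff f z" and r: "r > 0" and w: "w \<in> ball 0 r"
  shows "cpartial k f w = integral (cbox 0 1)
    (\<lambda>t::real. f (w + axis k (of_real (r/2) * exp (2 * pi * \<i> * t))) * (exp (- (2 * pi * \<i> * t)) * of_real (2 / r)))"
proof -
  let ?g = "\<lambda>t. f (w + axis k t)"
  have in2: "w + axis k t \<in> ball 0 (2 * r)" if "t \<in> cball 0 (r/2)" for t
    using that w r norm_triangle_ineq[of w "axis k t"] by (auto simp: norm_axis_complex)
  have der: "(?g has_field_derivative cpartial k f (w + axis k t)) (at t)" if "t \<in> cball 0 (r/2)" for t
    by (rule cdiff_slice[OF cd[OF in2[OF that]]])
  have cont: "continuous_on (cball 0 (r/2)) ?g"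
    by (rule continuous_at_imp_continuous_on) (use der DERIV_isCont in blast)
  have hol: "?g holomorphic_on ball 0 (r/2)"
    unfolding holomorphic_on_def field_differentiable_def
    using der has_field_derivative_at_within ball_subset_cball by blast
  have "(?g has_field_derivative (1 / (2 * of_real pi * \<i>) *
      contour_integral(circlepath 0 (r/2)) (\<lambda>u. ?g u / (u-0)^2))) (at 0)"
    by (rule Cauchy_derivative_integral_circlepath(2)[OF cont hol]) (use r in simp)
  then have "cpartial k f w = 1 / (2 * of_real pi * \<i>) *
      contour_integral(circlepath 0 (r/2)) (\<lambda>u. ?g u / (u-0)^2)"
    unfolding cpartial_def by (rule DERIV_imp_deriv)
  also have "\<dots> = integral {0..1} (\<lambda>t. 1 / (2 * of_real pi * \<i>) *
      (?g (circlepath 0 (r/2) t) / (circlepath 0 (r/2) t - 0)^2 * 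
        (2 * pi * \<i> * (r/2) * exp(2 * of_real pi * \<i> * t))))"
    unfolding contour_integral_integral vector_derivative_circlepath
    by (rule integral_mult_right[symmetric])
  also have "\<dots> = integral {0..1} (\<lambda>t::real. f (w + axis k (of_real (r/2) * exp (2 * pi * \<i> * t))) *
      (exp (- (2 * pi * \<i> * t)) * of_real (2 / r)))"
    by (rule arg_cong[of _ _ "integral {0..1}"])
       (use r in \<open>auto simp: fun_eq_iff circlepath field_simps exp_minus power2_eq_square\<close>)
  finally show ?thesis by simp
qed

lemma cpartial_continuous:
  fixes f :: "complex ^ 'n \<Rightarrow> complex"
  assumes cd: "\<And>z. z \<in> ball 0 (2 * r) \<Longrightarrow> cdiff f z" and r: "r > 0"
  shows "continuous_on (ball 0 r) (cpartial k f)"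
proof -
  have cf: "continuous_on (ball 0 (2 * r)) f"
    by (rule continuous_at_imp_continuous_on)
       (use cd cdiff_isCont in blast)
  have in2: "w + axis k (of_real (r/2) * exp (2 * pi * \<i> * t)) \<in> ball 0 (2 * r)"
    if "w \<in> ball 0 r" for w :: "complex ^ 'n" and t :: real
    using that r norm_triangle_ineq[of w "axis k (of_real (r/2) * exp (2 * pi * \<i> * t))"]
    by (auto simp: norm_axis_complex norm_mult)
  note ax = bounded_linear.continuous_on[OF bounded_linear_axis_complex]
  have "continuous_on (ball 0 r) (\<lambda>w. integral (cbox 0 1)
    (\<lambda>t::real. f (w + axis k (of_real (r/2) * exp (2 * pi * \<i> * t))) * (exp (- (2 * pi * \<i> * t)) * of_real (2 / r))))"
    apply (rule integral_continuous_on_param)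
    unfolding split_beta
    apply (intro continuous_intros continuous_on_compose2[OF cf] ax)
    using in2 r by auto
  then show ?thesis
    by (rule continuous_on_cong[THEN iffD1, rotated -1])
       (use cpartial_cauchy[OF cd r] in auto)
qed

lemma cdiff_of_cpartial:
  fixes f :: "complex ^ 'n \<Rightarrow> complex"
  assumes cd: "\<And>z. z \<in> ball 0 (4 * r) \<Longrightarrow> cdiff f z" and r: "r > 0" and w: "w \<in> ball 0 r"
  shows "cdiff (cpartial k f) w"
proof -
  have cd2: "cdiff f z" if "z \<in> ball 0 (2 * r)" for z using cd that r by auto
  have cp: "continuous_on (ball 0 (2 * r)) (cpartial i f)" for i
    by (rule cpartial_continuous) (use cd r in auto)
  have cf: "continuous_on (ball 0 (2 * r)) f"
    by (rule continuous_at_imp_continuous_on)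
       (use cd2 cdiff_isCont in blast)
  define p where "p w t = w + axis k (of_real (r/2) * exp (2 * pi * \<i> * t))" for w :: "complex ^ 'n" and t :: real
  define K where "K t = exp (- (2 * pi * \<i> * t)) * of_real (2 / r)" for t :: real
  have in2: "p w t \<in> ball 0 (2 * r)" if "w \<in> ball 0 r" for w t
    unfolding p_def
    using that r norm_triangle_ineq[of w "axis k (of_real (r/2) * exp (2 * pi * \<i> * t))"]
    by (auto simp: norm_axis_complex norm_mult)
  note ax = bounded_linear.continuous_on[OF bounded_linear_axis_complex]
  define L where "L w t v = (\<Sum>i\<in>UNIV. v $ i * cpartial i f (p w t)) * K t" for w t and v :: "complex ^ 'n"
  have Lbl: "bounded_linear (L w t)" for w t
    unfolding L_def
    by (intro bounded_linear_mult_left[THEN bounded_linear_compose] bounded_linear_sum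
         bounded_linear_vec_nth)
  define B where "B w t = Blinfun (L w t)" for w t
  have B: "blinfun_apply (B w t) = L w t" for w t
    unfolding B_def by (rule bounded_linear_Blinfun_apply[OF Lbl])
  have pc: "continuous_on (ball 0 r \<times> cbox 0 1) (\<lambda>x. p (fst x) (snd x))"
    unfolding p_def by (intro continuous_intros ax) (use r in auto)
  have Kc: "continuous_on S K" for S
    unfolding K_def by (intro continuous_intros) (use r in auto)
  have "((\<lambda>w. integral (cbox 0 1) (\<lambda>t. f (p w t) * K t)) has_derivative
      integral (cbox 0 1) (B w)) (at w within ball 0 r)"
  proof (rule leibniz_rule[OF _ _ _ w convex_ball])
    fix x :: "complex ^ 'n" and t :: real assume x: "x \<in> ball 0 r"
    have 1: "((\<lambda>x. p x t) has_derivative (\<lambda>v. v)) (at x)"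
      unfolding p_def by (auto intro!: derivative_eq_intros)
    have "((\<lambda>x. f (p x t)) has_derivative (\<lambda>v. \<Sum>i\<in>UNIV. v $ i * cpartial i f (p x t))) (at x)"
      using diff_chain_at[OF 1 cdiff_cpartial(2)[OF cd2[OF in2[OF x]]]] by (simp add: o_def)
    then have "((\<lambda>x. f (p x t) * K t) has_derivative L x t) (at x)"
      unfolding L_def by (rule has_derivative_mult_left)
    then show "((\<lambda>x. f (p x t) * K t) has_derivative blinfun_apply (B x t)) (at x within ball 0 r)"
      unfolding B by (rule has_derivative_at_withinI)
  next
    fix x :: "complex ^ 'n" assume x: "x \<in> ball 0 r"
    have "continuous_on (cbox 0 1) (\<lambda>t. f (p x t) * K t)"
      apply (intro continuous_intros Kc continuous_on_compose2[OF cf])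
      subgoal unfolding p_def by (intro continuous_intros ax) (use r in auto)
      subgoal using in2[OF x] by auto
      done
    then show "(\<lambda>t. f (p x t) * K t) integrable_on cbox 0 1"
      by (rule integrable_continuous)
  next
    show "continuous_on (ball 0 r \<times> cbox 0 1) (\<lambda>(x, t). B x t)"
      unfolding split_beta
    proof (rule continuous_on_blinfun_componentwise)
      fix b :: "complex ^ 'n"
      show "continuous_on (ball 0 r \<times> cbox 0 1) (\<lambda>x. blinfun_apply (B (fst x) (snd x)) b)"
        unfolding B L_def
        by (intro continuous_intros continuous_on_compose2[OF cp pc]
             continuous_on_compose2[OF Kc[of UNIV]]) (use in2 in auto)
    qed
  qed
  then have d: "((\<lambda>w. integral (cbox 0 1) (\<lambda>t. f (p w t) * K t)) has_derivative
      integral (cbox 0 1) (B w)) (at w)"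
    using w by (simp add: at_within_open[OF w])
  have Bint: "(B w) integrable_on cbox 0 1"
  proof (rule integrable_continuous, rule continuous_on_blinfun_componentwise)
    fix b :: "complex ^ 'n"
    have pw: "continuous_on (cbox 0 1) (p w)"
      unfolding p_def by (intro continuous_intros ax) (use r in auto)
    show "continuous_on (cbox 0 1) (\<lambda>x. blinfun_apply (B w x) b)"
      unfolding B L_def
      by (intro continuous_intros continuous_on_compose2[OF cp pw] Kc) (use in2[OF w] in auto)
  qed
  have lin: "blinfun_apply (integral (cbox 0 1) (B w)) (c *s v) =
      c * blinfun_apply (integral (cbox 0 1) (B w)) v" for c v
  proof -
    have app: "blinfun_apply (integral (cbox 0 1) (B w)) v = integral (cbox 0 1) (\<lambda>t. L w t v)" for v
      using integral_linear[OF Bint, of "\<lambda>A. blinfun_apply A v"]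
      by (simp add: o_def B blinfun.bounded_linear_left)
    have "L w t (c *s v) = c * L w t v" for t
      unfolding L_def by (simp add: sum_distrib_left algebra_simps sum_distrib_right)
    then show ?thesis unfolding app by simp
  qed
  have "(cpartial k f has_derivative blinfun_apply (integral (cbox 0 1) (B w))) (at w)"
  proof (rule has_derivative_transform_within_open[OF d open_ball w])
    fix x :: "complex ^ 'n" assume x: "x \<in> ball 0 r"
    show "integral (cbox 0 1) (\<lambda>t. f (p x t) * K t) = cpartial k f x"
      unfolding p_def K_def by (rule cpartial_cauchy[OF cd2 r x, symmetric])
  qed
  with lin show ?thesis unfolding cdiff_def by blast
qed

lemma holo_near_0_cpartial:
  assumes "holo_near_0 f"
  shows "holo_near_0 (cpartial k f)"
proof -
  from assms obtain e where e: "e > 0" "\<And>z. z \<in> ball 0 e \<Longrightarrow> cdiff f z"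
    unfolding holo_near_0_def eventually_nhds_metric by (auto simp: dist_commute)
  have "cdiff (cpartial k f) z" if "z \<in> ball 0 (e/4)" for z
    by (rule cdiff_of_cpartial[of "e/4"]) (use e that in auto)
  then show ?thesis
    unfolding holo_near_0_def eventually_nhds_metric
    by (intro exI[of _ "e/4"]) (use e in \<open>auto simp: dist_commute\<close>)
qed

lemma cpartial_cong:
  assumes "\<forall>\<^sub>F z in nhds 0. f z = g z"
  shows "\<forall>\<^sub>F z in nhds 0. cpartial k f z = cpartial k g z"
proof -
  from assms have "\<forall>\<^sub>F z in nhds 0. \<forall>\<^sub>F w in nhds z. f w = g w"
    by (simp add: eventually_eventually)
  then show ?thesis
  proof eventually_elim
    case (elim z)
    have "continuous (at 0) (\<lambda>t::complex. z + axis k t)"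
      by (intro continuous_intros bounded_linear.continuous[OF bounded_linear_axis_complex])
    then have "((\<lambda>t::complex. z + axis k t) \<longlongrightarrow> z + axis k 0) (nhds 0)"
      using tendsto_at_iff_tendsto_nhds[of "\<lambda>t::complex. z + axis k t" 0]
      by (simp add: continuous_at)
    moreover have "z + axis k 0 = z" by (simp add: vec_eq_iff axis_def)
    ultimately have "((\<lambda>t::complex. z + axis k t) \<longlongrightarrow> z) (nhds 0)" by simp
    with elim have "\<forall>\<^sub>F t in nhds 0. f (z + axis k t) = g (z + axis k t)"
      unfolding filterlim_iff by blast
    then show ?case unfolding cpartial_def by (rule deriv_cong_ev) simp
  qed
qed


section \<open>The algebra of holomorphic germs\<close>

definition germ_rel :: "(complex ^ 'n \<Rightarrow> complex) \<Rightarrow> (complex ^ 'n \<Rightarrow> complex) \<Rightarrow> bool" where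
  "germ_rel f g \<longleftrightarrow> holo_near_0 f \<and> holo_near_0 g \<and> (\<forall>\<^sub>F z in nhds 0. f z = g z)"

lemma part_equivp_germ_rel: "part_equivp germ_rel"
proof (rule part_equivpI)
  show "\<exists>f. germ_rel f f"
    by (rule exI[of _ "\<lambda>_. 0"]) (simp add: germ_rel_def holo_near_0_def cdiff_const)
  show "symp germ_rel"
  proof (rule sympI)
    fix f g :: "complex ^ 'n \<Rightarrow> complex"
    assume *: "germ_rel f g"
    then have "\<forall>\<^sub>F z in nhds 0. f z = g z" by (simp add: germ_rel_def)
    then have "\<forall>\<^sub>F z in nhds 0. g z = f z" by eventually_elim simp
    with * show "germ_rel g f" by (simp add: germ_rel_def)
  qed
  show "transp germ_rel"
  proof (rule transpI)
    fix f g h :: "complex ^ 'n \<Rightarrow> complex"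
    assume *: "germ_rel f g" "germ_rel g h"
    then have "\<forall>\<^sub>F z in nhds 0. f z = g z" "\<forall>\<^sub>F z in nhds 0. g z = h z"
      by (simp_all add: germ_rel_def)
    then have "\<forall>\<^sub>F z in nhds 0. f z = h z" by eventually_elim simp
    with * show "germ_rel f h" by (simp add: germ_rel_def)
  qed
qed

quotient_type (overloaded) 'n germ = "complex ^ ('n::finite) \<Rightarrow> complex" / partial: germ_rel
  by (rule part_equivp_germ_rel)

lemma germ_rel_refl: "germ_rel f f \<longleftrightarrow> holo_near_0 f"
  by (simp add: germ_rel_def)

lemma germ_rel_const: "germ_rel (\<lambda>_. c) (\<lambda>_. c)"
  by (simp add: germ_rel_def holo_near_0_def cdiff_const)

lemma germ_rel_add:
  assumes "germ_rel f f'" "germ_rel g g'"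
  shows "germ_rel (\<lambda>z. f z + g z) (\<lambda>z. f' z + g' z)"
proof -
  have h: "holo_near_0 (\<lambda>z. f z + g z)" if "holo_near_0 f" "holo_near_0 g" for f g :: "complex ^ 'a \<Rightarrow> complex"
    using that unfolding holo_near_0_def by eventually_elim (rule cdiff_add)
  from assms have "\<forall>\<^sub>F z in nhds 0. f z = f' z" "\<forall>\<^sub>F z in nhds 0. g z = g' z"
    by (auto simp: germ_rel_def)
  then have "\<forall>\<^sub>F z in nhds 0. f z + g z = f' z + g' z" by eventually_elim simp
  with assms show ?thesis by (simp add: germ_rel_def h)
qed

lemma germ_rel_mult:
  assumes "germ_rel f f'" "germ_rel g g'"
  shows "germ_rel (\<lambda>z. f z * g z) (\<lambda>z. f' z * g' z)"
proof -
  have h: "holo_near_0 (\<lambda>z. f z * g z)" if "holo_near_0 f" "holo_near_0 g" for f g :: "complex ^ 'a \<Rightarrow> complex"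
    using that unfolding holo_near_0_def by eventually_elim (rule cdiff_mult)
  from assms have "\<forall>\<^sub>F z in nhds 0. f z = f' z" "\<forall>\<^sub>F z in nhds 0. g z = g' z"
    by (auto simp: germ_rel_def)
  then have "\<forall>\<^sub>F z in nhds 0. f z * g z = f' z * g' z" by eventually_elim simp
  with assms show ?thesis by (simp add: germ_rel_def h)
qed

lemma germ_rel_uminus:
  assumes "germ_rel f f'"
  shows "germ_rel (\<lambda>z. - f z) (\<lambda>z. - f' z)"
proof -
  have h: "holo_near_0 (\<lambda>z. - f z)" if "holo_near_0 f" for f :: "complex ^ 'a \<Rightarrow> complex"
    using that unfolding holo_near_0_def by eventually_elim (rule cdiff_minus)
  from assms have "\<forall>\<^sub>F z in nhds 0. f z = f' z" by (simp add: germ_rel_def)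
  then have "\<forall>\<^sub>F z in nhds 0. - f z = - f' z" by eventually_elim simp
  with assms show ?thesis by (simp add: germ_rel_def h)
qed

lift_definition germ_const :: "complex \<Rightarrow> 'n::finite germ" is "\<lambda>c _. c"
  by (rule germ_rel_const)

instantiation germ :: (finite) comm_ring_1
begin

lift_definition zero_germ :: "'a germ" is "\<lambda>_. 0"
  by (rule germ_rel_const)

lift_definition one_germ :: "'a germ" is "\<lambda>_. 1"
  by (rule germ_rel_const)

lift_definition plus_germ :: "'a germ \<Rightarrow> 'a germ \<Rightarrow> 'a germ" is "\<lambda>f g z. f z + g z"
  by (rule germ_rel_add)

lift_definition uminus_germ :: "'a germ \<Rightarrow> 'a germ" is "\<lambda>f z. - f z"
  by (rule germ_rel_uminus)

lift_definition times_germ :: "'a germ \<Rightarrow> 'a germ \<Rightarrow> 'a germ" is "\<lambda>f g z. f z * g z"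
  by (rule germ_rel_mult)

definition minus_germ :: "'a germ \<Rightarrow> 'a germ \<Rightarrow> 'a germ" where
  "minus_germ f g = f + (- g)"

instance
proof
  fix a b c :: "'a germ"
  note [simp] = germ_rel_refl germ_rel_const
  have hc: "holo_near_0 (\<lambda>z. c)" for c
    using germ_rel_const germ_rel_refl by metis
  have ha: "holo_near_0 (\<lambda>z. f z + g z)" if "holo_near_0 f" "holo_near_0 g" for f g :: "complex ^ 'a \<Rightarrow> complex"
    using germ_rel_add[of f f g g] that by simp
  have hm: "holo_near_0 (\<lambda>z. f z * g z)" if "holo_near_0 f" "holo_near_0 g" for f g :: "complex ^ 'a \<Rightarrow> complex"
    using germ_rel_mult[of f f g g] that by simp
  note h = hc ha hm
  show "a + b + c = a + (b + c)" by transfer (simp add: h add.assoc)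
  show "a + b = b + a" by transfer (simp add: h add.commute)
  show "0 + a = a" by transfer simp
  show "- a + a = 0" by transfer (simp add: h)
  show "a - b = a + - b" by (simp add: minus_germ_def)
  show "a * b * c = a * (b * c)" by transfer (simp add: h mult.assoc)
  show "a * b = b * a" by transfer (simp add: h mult.commute)
  show "1 * a = a" by transfer simp
  show "(a + b) * c = a * c + b * c" by transfer (simp add: h distrib_right)
  show "0 \<noteq> (1 :: 'a germ)"
  proof transfer
    show "\<not> germ_rel (\<lambda>_. 0) (\<lambda>_ :: complex ^ 'a. 1)"
      by (simp add: germ_rel_def)
  qed
qed

end

lift_definition germ_deriv :: "'n \<Rightarrow> 'n::finite germ \<Rightarrow> 'n germ" is cpartial
  unfolding germ_rel_def using holo_near_0_cpartial cpartial_cong by blast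

text \<open>
  The hypersurface germ \<^term>\<open>V(F)\<close> has an isolated singularity at the origin: the origin
  is a singular point of \<^term>\<open>V(F)\<close>, and there is no other one in some neighbourhood.
\<close>

lift_definition isolated_singularity :: "'n::finite germ \<Rightarrow> bool" is
  "\<lambda>f. f 0 = 0 \<and> (\<forall>k. cpartial k f 0 = 0) \<and>
    (\<forall>\<^sub>F z in at 0. \<not> (f z = 0 \<and> (\<forall>k. cpartial k f z = 0)))"
proof -
  fix f g :: "complex ^ 'n \<Rightarrow> complex"
  assume "germ_rel f g"
  then have ev: "\<forall>\<^sub>F z in nhds 0. f z = g z" by (simp add: germ_rel_def)
  from ev have "\<forall>\<^sub>F z in nhds 0. \<forall>k. cpartial k f z = cpartial k g z"
    by (intro eventually_all_finite cpartial_cong)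
  with ev have *: "\<forall>\<^sub>F z in nhds 0. f z = g z \<and> (\<forall>k. cpartial k f z = cpartial k g z)"
    by (rule eventually_conj)
  then have at0: "\<forall>\<^sub>F z in at 0. f z = g z \<and> (\<forall>k. cpartial k f z = cpartial k g z)"
    by (simp add: eventually_nhds_conv_at)
  show "(f 0 = 0 \<and> (\<forall>k. cpartial k f 0 = 0) \<and>
      (\<forall>\<^sub>F z in at 0. \<not> (f z = 0 \<and> (\<forall>k. cpartial k f z = 0)))) =
    (g 0 = 0 \<and> (\<forall>k. cpartial k g 0 = 0) \<and>
      (\<forall>\<^sub>F z in at 0. \<not> (g z = 0 \<and> (\<forall>k. cpartial k g z = 0))))"
  proof -
    have "f 0 = g 0" "\<And>k. cpartial k f 0 = cpartial k g 0"
      using eventually_nhds_x_imp_x[OF *] by auto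
    moreover have "(\<forall>\<^sub>F z in at 0. \<not> (f z = 0 \<and> (\<forall>k. cpartial k f z = 0))) =
        (\<forall>\<^sub>F z in at 0. \<not> (g z = 0 \<and> (\<forall>k. cpartial k g z = 0)))"
      by (rule eventually_subst, rule eventually_mono[OF at0]) simp
    ultimately show ?thesis by simp
  qed
qed


section \<open>Germs of holomorphic maps fixing the origin\<close>

definition map_germ_rel ::
  "(complex ^ 'n \<Rightarrow> complex ^ 'n) \<Rightarrow> (complex ^ 'n \<Rightarrow> complex ^ 'n) \<Rightarrow> bool" where
  "map_germ_rel \<phi> \<psi> \<longleftrightarrow>
    \<phi> 0 = 0 \<and> (\<forall>i. holo_near_0 (\<lambda>z. \<phi> z $ i)) \<and>
    \<psi> 0 = 0 \<and> (\<forall>i. holo_near_0 (\<lambda>z. \<psi> z $ i)) \<and> (\<forall>\<^sub>F z in nhds 0. \<phi> z = \<psi> z)"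

lemma map_germ_rel_id: "map_germ_rel (\<lambda>z. z) (\<lambda>z. z)"
  by (simp add: map_germ_rel_def holo_near_0_def cdiff_nth)

lemma part_equivp_map_germ_rel: "part_equivp map_germ_rel"
proof (rule part_equivpI)
  show "\<exists>f. map_germ_rel f f" using map_germ_rel_id by blast
  show "symp map_germ_rel"
  proof (rule sympI)
    fix f g :: "complex ^ 'n \<Rightarrow> complex ^ 'n"
    assume *: "map_germ_rel f g"
    then have "\<forall>\<^sub>F z in nhds 0. f z = g z" by (simp add: map_germ_rel_def)
    then have "\<forall>\<^sub>F z in nhds 0. g z = f z" by eventually_elim simp
    with * show "map_germ_rel g f" by (simp add: map_germ_rel_def)
  qed
  show "transp map_germ_rel"
  proof (rule transpI)
    fix f g h :: "complex ^ 'n \<Rightarrow> complex ^ 'n"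
    assume *: "map_germ_rel f g" "map_germ_rel g h"
    then have "\<forall>\<^sub>F z in nhds 0. f z = g z" "\<forall>\<^sub>F z in nhds 0. g z = h z"
      by (simp_all add: map_germ_rel_def)
    then have "\<forall>\<^sub>F z in nhds 0. f z = h z" by eventually_elim simp
    with * show "map_germ_rel f h" by (simp add: map_germ_rel_def)
  qed
qed

quotient_type (overloaded) 'n map_germ = "complex ^ ('n::finite) \<Rightarrow> complex ^ 'n" / partial: map_germ_rel
  by (rule part_equivp_map_germ_rel)

lemma map_germ_tendsto:
  fixes \<phi> :: "complex ^ 'n \<Rightarrow> complex ^ 'n"
  assumes "\<phi> 0 = 0" "\<And>i. holo_near_0 (\<lambda>z. \<phi> z $ i)"
  shows "filterlim \<phi> (nhds 0) (nhds 0)"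
proof -
  have "cdiff (\<lambda>z. \<phi> z $ i) 0" for i
    by (rule eventually_nhds_x_imp_x[OF assms(2)[of i, unfolded holo_near_0_def]])
  from vec_nth_cdiff_has_derivative[OF this] obtain D where "(\<phi> has_derivative D) (at 0)"
    by blast
  then have "continuous (at 0) \<phi>"
    by (rule has_derivative_continuous)
  then show ?thesis
    using assms(1) tendsto_at_iff_tendsto_nhds[of \<phi> 0] by (simp add: continuous_at)
qed

lemma holo_near_0_compose:
  fixes \<phi> :: "complex ^ 'n \<Rightarrow> complex ^ 'n"
  assumes "holo_near_0 f" "\<phi> 0 = 0" "\<And>i. holo_near_0 (\<lambda>z. \<phi> z $ i)"
  shows "holo_near_0 (\<lambda>z. f (\<phi> z))"
proof -
  have "\<forall>\<^sub>F z in nhds 0. cdiff f (\<phi> z)"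
    using map_germ_tendsto[OF assms(2,3)] assms(1)
    unfolding filterlim_iff holo_near_0_def by blast
  moreover have "\<forall>\<^sub>F z in nhds 0. \<forall>i. cdiff (\<lambda>z. \<phi> z $ i) z"
    using assms(3) by (intro eventually_all_finite) (simp add: holo_near_0_def)
  ultimately show ?thesis
    unfolding holo_near_0_def by eventually_elim (rule cdiff_compose; simp)
qed

lemma eventually_compose_eq:
  fixes f g :: "complex ^ 'n \<Rightarrow> 'b" and \<phi> \<psi> :: "complex ^ 'n \<Rightarrow> complex ^ 'n"
  assumes "\<forall>\<^sub>F z in nhds 0. f z = g z" "map_germ_rel \<phi> \<psi>"
  shows "\<forall>\<^sub>F z in nhds 0. f (\<phi> z) = g (\<psi> z)"
proof -
  have "filterlim \<phi> (nhds 0) (nhds 0)"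
    using assms(2) by (intro map_germ_tendsto) (auto simp: map_germ_rel_def)
  then have "\<forall>\<^sub>F z in nhds 0. f (\<phi> z) = g (\<phi> z)"
    using assms(1) unfolding filterlim_iff by blast
  moreover have "\<forall>\<^sub>F z in nhds 0. \<phi> z = \<psi> z"
    using assms(2) by (simp add: map_germ_rel_def)
  ultimately show ?thesis by eventually_elim simp
qed

lift_definition germ_comp :: "'n::finite germ \<Rightarrow> 'n map_germ \<Rightarrow> 'n germ" (infixl \<open>\<circ>\<^sub>g\<close> 75)
  is "\<lambda>f \<phi> z. f (\<phi> z)"
proof -
  fix f g :: "complex ^ 'n \<Rightarrow> complex" and \<phi> \<psi> :: "complex ^ 'n \<Rightarrow> complex ^ 'n"
  assume *: "germ_rel f g" "map_germ_rel \<phi> \<psi>"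
  then have "holo_near_0 (\<lambda>z. f (\<phi> z))" "holo_near_0 (\<lambda>z. g (\<psi> z))"
    using holo_near_0_compose[of f \<phi>] holo_near_0_compose[of g \<psi>]
    by (simp_all add: germ_rel_def map_germ_rel_def)
  with * show "germ_rel (\<lambda>z. f (\<phi> z)) (\<lambda>z. g (\<psi> z))"
    by (simp add: germ_rel_def eventually_compose_eq)
qed

lift_definition map_germ_id :: "'n::finite map_germ" is "\<lambda>z. z"
  by (rule map_germ_rel_id)

lift_definition map_germ_comp :: "'n::finite map_germ \<Rightarrow> 'n map_germ \<Rightarrow> 'n map_germ"
  is "\<lambda>\<phi> \<psi> z. \<phi> (\<psi> z)"
proof -
  fix \<phi> \<phi>' \<psi> \<psi>' :: "complex ^ 'n \<Rightarrow> complex ^ 'n"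
  assume *: "map_germ_rel \<phi> \<phi>'" "map_germ_rel \<psi> \<psi>'"
  then have "holo_near_0 (\<lambda>z. \<phi> (\<psi> z) $ i)" "holo_near_0 (\<lambda>z. \<phi>' (\<psi>' z) $ i)" for i
    using holo_near_0_compose[of "\<lambda>z. \<phi> z $ i" \<psi>] holo_near_0_compose[of "\<lambda>z. \<phi>' z $ i" \<psi>']
    by (simp_all add: map_germ_rel_def)
  moreover have "\<forall>\<^sub>F z in nhds 0. \<phi> (\<psi> z) = \<phi>' (\<psi>' z)"
    by (rule eventually_compose_eq[OF _ *(2)]) (use *(1) in \<open>simp add: map_germ_rel_def\<close>)
  ultimately show "map_germ_rel (\<lambda>z. \<phi> (\<psi> z)) (\<lambda>z. \<phi>' (\<psi>' z))"
    using * by (simp add: map_germ_rel_def)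
qed

definition biholomorphic_germ :: "'n::finite map_germ \<Rightarrow> bool" where
  "biholomorphic_germ \<phi> \<longleftrightarrow>
    (\<exists>\<psi>. map_germ_comp \<phi> \<psi> = map_germ_id \<and> map_germ_comp \<psi> \<phi> = map_germ_id)"


section \<open>The second Jacobian matrix and the second Jacobian ideal\<close>

text \<open>
  The ordered index set \<open>{1..n}\<close> of the coordinates is the type \<^typ>\<open>'n\<close>. The labels
  \<open>{0..n}\<close> are the type \<^typ>\<open>'n option\<close>, where \<^term>\<open>None\<close> is the index 0 and, by the order
  of \<^theory>\<open>HOL-Library.Option_ord\<close>, the smallest element. The pair \<^term>\<open>(i, j)\<close> is the
  column label \<open>\<beta>\<^sub>i\<^sub>j\<close>.
\<close>

definition jac2_cols :: "('n::{finite,linorder} option \<times> 'n option) set" where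
  "jac2_cols = {(i, j). i \<le> j \<and> (i, j) \<noteq> (None, None)}"

definition col_less ::
  "'n::{finite,linorder} option \<times> 'n option \<Rightarrow> 'n option \<times> 'n option \<Rightarrow> bool" where
  "col_less c d \<longleftrightarrow> fst c < fst d \<or> fst c = fst d \<and> snd c < snd d"

text \<open>Only the entries in the columns \<^const>\<open>jac2_cols\<close> are meaningful.\<close>

fun jac2 :: "'n::{finite,linorder} germ \<Rightarrow> 'n option \<Rightarrow> 'n option \<times> 'n option \<Rightarrow> 'n germ" where
  "jac2 F None (None, Some j) = germ_deriv j F"
| "jac2 F None (Some i, Some j) =
    (if i = j then germ_const (1/2) * germ_deriv i (germ_deriv i F)
     else germ_deriv i (germ_deriv j F))"
| "jac2 F (Some k) (None, Some j) = 0"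
| "jac2 F (Some k) (Some i, Some j) =
    (if k = i then germ_deriv j F else if k = j then germ_deriv i F else 0)"
| "jac2 F _ (_, None) = 0"

text \<open>
  A maximal minor selects \<^term>\<open>n + 1\<close> columns, in increasing order; \<^term>\<open>s r\<close> is the
  column put in position \<^term>\<open>r\<close>.
\<close>

definition jac2_maximal_minors :: "'n::{finite,linorder} germ \<Rightarrow> 'n germ set" where
  "jac2_maximal_minors F =
    {det (\<chi> r p. jac2 F r (s p)) |s :: 'n option \<Rightarrow> 'n option \<times> 'n option.
      range s \<subseteq> jac2_cols \<and> (\<forall>p q. p < q \<longrightarrow> col_less (s p) (s q))}"

definition germ_algebra :: "(complex, 'n::finite germ) module" where
  "germ_algebra = \<lparr>carrier = UNIV, mult = (*), one = 1, zero = 0, add = (+),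
    smult = (\<lambda>c f. germ_const c * f)\<rparr>"

definition jacobian_ideal2 :: "'n::{finite,linorder} germ \<Rightarrow> 'n germ set" where
  "jacobian_ideal2 F = genideal germ_algebra (jac2_maximal_minors F)"


section \<open>The second Nash blow-up local algebra\<close>

text \<open>The scalar multiplication on cosets follows the pattern of \<^const>\<open>rcoset_mult\<close>.\<close>

definition quotient_algebra :: "('c, 'a) module \<Rightarrow> 'a set \<Rightarrow> ('c, 'a set) module" where
  "quotient_algebra A J = ring.extend (A Quot J)
    (module.fields (\<lambda>c X. \<Union>x\<in>X. J +>\<^bsub>A\<^esub> (c \<odot>\<^bsub>A\<^esub> x)))"

definition algebra_iso :: "('c, 'a) module \<Rightarrow> ('c, 'b) module \<Rightarrow> ('a \<Rightarrow> 'b) set" where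
  "algebra_iso A B = {h \<in> ring_iso A B. \<forall>c. \<forall>x \<in> carrier A. h (c \<odot>\<^bsub>A\<^esub> x) = c \<odot>\<^bsub>B\<^esub> h x}"

definition algebras_isomorphic :: "('c, 'a) module \<Rightarrow> ('c, 'b) module \<Rightarrow> bool" where
  "algebras_isomorphic A B \<longleftrightarrow> algebra_iso A B \<noteq> {}"

definition nash_algebra2 :: "'n::{finite,linorder} germ \<Rightarrow> (complex, 'n germ set) module" where
  "nash_algebra2 F = quotient_algebra germ_algebra
    (genideal germ_algebra (insert F (jacobian_ideal2 F)))"

end

theory Submission
  imports Defs
begin

text \<open>
  Let \<open>\<delta>F = F(z + x) - F(z)\<close>. The rows of the second Jacobian matrix are the coefficients of
  \<open>\<delta>F, x\<^sub>1 \<delta>F, \<dots>, x\<^sub>n \<delta>F\<close> modulo \<open>(x)\<^sup>3\<close>. Since \<open>\<delta>(u F) \<equiv> (u + \<delta>u) \<delta>F\<close> modulo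
  \<open>F\<close>, multiplication by \<open>u\<close> is a row operation modulo \<open>F\<close>. Composition with \<open>\<phi>\<close>
  substitutes \<open>\<delta>\<phi>\<close> for \<open>x\<close>, which is a column operation together with an invertible row operation
  given by the Jacobian matrix of \<open>\<phi>\<close>. Hence the pullback of
  \<open>(F, J\<^sub>2(F))\<close> by \<open>\<phi>\<close> contains \<open>(G, J\<^sub>2(G))\<close>, and the inverses of \<open>u\<close> and
  \<open>\<phi>\<close> give the other inclusion.
\<close>

section \<open>Calculus of germs\<close>

text \<open>\<open>cpartial_cauchy\<close> expresses the derivative in direction \<open>j\<close> as
  a circle integral of \<open>f\<close>. Differentiating under the integral in direction
  \<open>i\<close> gives the same integral with \<open>cpartial i f\<close> in place of
  \<open>f\<close>, which is Cauchy's formula again.\<close>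

lemma cpartial_commute_ball:
  fixes f :: "complex ^ 'n \<Rightarrow> complex"
  assumes cd: "\<And>z. z \<in> ball 0 (8 * r) \<Longrightarrow> cdiff f z" and r: "r > 0" and w: "w \<in> ball 0 r"
  shows "cpartial i (cpartial j f) w = cpartial j (cpartial i f) w"
proof -
  define p where "p x t = x + axis j (of_real (r/2) * exp (2 * pi * \<i> * t))"
    for x :: "complex ^ 'n" and t :: real
  define K where "K t = exp (- (2 * pi * \<i> * t)) * of_real (2 / r)" for t :: real
  have cd2: "cdiff f z" if "z \<in> ball 0 (2 * r)" for z using cd that r by auto
  \<comment> \<open>\<open>cdiff_of_cpartial\<close> shrinks the radius by a factor 4, and Cauchy's
    formula for \<open>cpartial i f\<close> needs the ball of radius \<open>2 * r\<close>; hence the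
    8 in \<open>cd\<close>.\<close>
  have cd3: "cdiff (cpartial i f) z" if "z \<in> ball 0 (2 * r)" for z
    by (rule cdiff_of_cpartial[of "2 * r"]) (use cd r that in auto)
  have cf: "continuous_on (ball 0 (2 * r)) f" "continuous_on (ball 0 (2 * r)) (cpartial i f)"
    by (rule continuous_at_imp_continuous_on, use cd2 cd3 cdiff_isCont in blast)+
  have in2: "p x t \<in> ball 0 (2 * r)" if "x \<in> ball 0 r" for x t
    unfolding p_def
    using that r norm_triangle_ineq[of x "axis j (of_real (r/2) * exp (2 * pi * \<i> * t))"]
    by (auto simp: norm_axis_complex norm_mult)
  define e where "e = r - norm w"
  have e: "e > 0" using w by (simp add: e_def)
  have inr: "w + axis i s \<in> ball 0 r" if "s \<in> ball 0 e" for s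
    using that norm_triangle_ineq[of w "axis i s"] by (auto simp: norm_axis_complex e_def)
  have p_shift: "p (w + axis i s) t = p w t + axis i s" for s :: complex and t
    by (simp add: p_def)
  note ax = bounded_linear.continuous_on[OF bounded_linear_axis_complex]
  have Kc: "continuous_on S K" for S
    unfolding K_def by (intro continuous_intros) (use r in auto)
  have axis0: "axis i 0 = (0 :: complex ^ 'n)" by (simp add: vec_eq_iff axis_def)
  have "((\<lambda>s. integral (cbox 0 1) (\<lambda>t. f (p (w + axis i s) t) * K t)) has_field_derivative
      integral (cbox 0 1) (\<lambda>t. cpartial i f (p (w + axis i 0) t) * K t)) (at 0 within ball 0 e)"
  proof (rule leibniz_rule_field_derivative[OF _ _ _ _ convex_ball])
    fix s :: complex and t :: real assume s: "s \<in> ball 0 e"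
    have "((\<lambda>s. f (p w t + axis i s)) has_field_derivative cpartial i f (p w t + axis i s)) (at s)"
      by (rule cdiff_slice) (use cd2 in2[OF inr[OF s], of t] in \<open>simp add: p_shift\<close>)
    then have "((\<lambda>s. f (p w t + axis i s) * K t) has_field_derivative
        cpartial i f (p w t + axis i s) * K t) (at s)"
      by (rule DERIV_cmult_right)
    then show "((\<lambda>s. f (p (w + axis i s) t) * K t) has_field_derivative
        cpartial i f (p (w + axis i s) t) * K t) (at s within ball 0 e)"
      unfolding p_shift by (rule has_field_derivative_at_within)
  next
    fix s :: complex assume s: "s \<in> ball 0 e"
    show "(\<lambda>t. f (p (w + axis i s) t) * K t) integrable_on cbox 0 1"
      apply (intro integrable_continuous continuous_intros Kc continuous_on_compose2[OF cf(1)])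
      subgoal unfolding p_def by (intro continuous_intros ax) (use r in auto)
      subgoal using in2[OF inr[OF s]] by auto
      done
  next
    have pc: "continuous_on (ball 0 e \<times> cbox 0 1) (\<lambda>x. p (w + axis i (fst x)) (snd x))"
      unfolding p_def by (intro continuous_intros ax) (use r in auto)
    show "continuous_on (ball 0 e \<times> cbox 0 1) (\<lambda>(s, t). cpartial i f (p (w + axis i s) t) * K t)"
      unfolding split_beta
    proof (rule continuous_on_mult)
      show "continuous_on (ball 0 e \<times> cbox 0 1) (\<lambda>x. cpartial i f (p (w + axis i (fst x)) (snd x)))"
        by (rule continuous_on_compose2[OF cf(2) pc]) (use in2 inr in auto)
      show "continuous_on (ball 0 e \<times> cbox 0 1) (\<lambda>x. K (snd x))"
        by (rule continuous_on_compose2[OF Kc[of UNIV] continuous_on_snd[OF continuous_on_id]]) auto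
    qed
  qed (use e in auto)
  then have "((\<lambda>s. integral (cbox 0 1) (\<lambda>t. f (p (w + axis i s) t) * K t)) has_field_derivative
      integral (cbox 0 1) (\<lambda>t. cpartial i f (p w t) * K t)) (at 0)"
    unfolding axis0 add_0_right using e by (subst (asm) at_within_open) auto
  also have "integral (cbox 0 1) (\<lambda>t. cpartial i f (p w t) * K t) = cpartial j (cpartial i f) w"
    unfolding p_def K_def by (rule cpartial_cauchy[OF cd3 r w, symmetric])
  finally have "((\<lambda>s. cpartial j f (w + axis i s)) has_field_derivative
      cpartial j (cpartial i f) w) (at 0)"
  proof (rule has_field_derivative_transform_within_open[OF _ open_ball[of 0 e]])
    fix s :: complex assume s: "s \<in> ball 0 e"
    show "integral (cbox 0 1) (\<lambda>t. f (p (w + axis i s) t) * K t) = cpartial j f (w + axis i s)"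
      unfolding p_def K_def by (rule cpartial_cauchy[OF cd2 r inr[OF s], symmetric])
  qed (use e in simp)
  then show ?thesis unfolding cpartial_def[of i] by (rule DERIV_imp_deriv)
qed

lemma holo_near_0_ball:
  assumes "holo_near_0 f"
  obtains e where "e > 0" "\<And>z. z \<in> ball 0 e \<Longrightarrow> cdiff f z"
  using assms unfolding holo_near_0_def eventually_nhds_metric by (auto simp: dist_commute)

lemma germ_deriv_commute: "germ_deriv i (germ_deriv j F) = germ_deriv j (germ_deriv i F)"
proof (transfer, unfold germ_rel_def, intro conjI holo_near_0_cpartial)
  fix i j :: 'a and f :: "complex ^ 'a \<Rightarrow> complex"
  assume "holo_near_0 f \<and> holo_near_0 f \<and> (\<forall>\<^sub>F z in nhds 0. f z = f z)"
  then obtain e where e: "e > 0" "\<And>z. z \<in> ball 0 e \<Longrightarrow> cdiff f z"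
    using holo_near_0_ball by blast
  have "cpartial i (cpartial j f) z = cpartial j (cpartial i f) z" if "z \<in> ball 0 (e/8)" for z
    by (rule cpartial_commute_ball[of "e/8"]) (use e that in auto)
  then show "\<forall>\<^sub>F z in nhds 0. cpartial i (cpartial j f) z = cpartial j (cpartial i f) z"
    unfolding eventually_nhds_metric
    by (intro exI[of _ "e/8"]) (use e in \<open>auto simp: dist_commute\<close>)
qed auto

section \<open>Sum and product rules\<close>

lemma cpartial_add:
  assumes "cdiff f z" "cdiff g z"
  shows "cpartial k (\<lambda>z. f z + g z) z = cpartial k f z + cpartial k g z"
  using DERIV_add[OF assms[THEN cdiff_cpartial(1)]]
  unfolding cpartial_def[of k "\<lambda>z. f z + g z"] by (rule DERIV_imp_deriv)

lemma cpartial_mult: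
  assumes "cdiff f z" "cdiff g z"
  shows "cpartial k (\<lambda>z. f z * g z) z = cpartial k f z * g z + f z * cpartial k g z"
proof -
  have "axis k 0 = (0 :: complex ^ 'a)" by (simp add: vec_eq_iff axis_def)
  with DERIV_mult[OF assms[THEN cdiff_cpartial(1), of k]]
  have "((\<lambda>t. f (z + axis k t) * g (z + axis k t)) has_field_derivative
      cpartial k f z * g z + cpartial k g z * f z) (at 0)"
    by simp
  then show ?thesis
    unfolding cpartial_def[of k "\<lambda>z. f z * g z"] by (simp add: DERIV_imp_deriv mult.commute)
qed

lemma germ_deriv_add: "germ_deriv k (f + g) = germ_deriv k f + germ_deriv k g"
proof (transfer, goal_cases)
  case (1 k f g)
  then have f: "holo_near_0 f" and g: "holo_near_0 g" by (simp_all add: germ_rel_refl)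
  have "holo_near_0 (cpartial k (\<lambda>z. f z + g z))"
    using germ_rel_add[OF 1] by (intro holo_near_0_cpartial) (simp add: germ_rel_refl)
  moreover have "holo_near_0 (\<lambda>z. cpartial k f z + cpartial k g z)"
    using germ_rel_add[of "cpartial k f" "cpartial k f" "cpartial k g" "cpartial k g"] f g
    by (simp add: germ_rel_refl holo_near_0_cpartial)
  moreover have "\<forall>\<^sub>F z in nhds 0. cpartial k (\<lambda>z. f z + g z) z = cpartial k f z + cpartial k g z"
    using f g unfolding holo_near_0_def by eventually_elim (rule cpartial_add)
  ultimately show ?case by (simp add: germ_rel_def)
qed

lemma germ_deriv_mult: "germ_deriv k (f * g) = germ_deriv k f * g + f * germ_deriv k g"
proof (transfer, goal_cases)
  case (1 k f g)
  then have f: "holo_near_0 f" and g: "holo_near_0 g" by (simp_all add: germ_rel_refl)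
  have "holo_near_0 (cpartial k (\<lambda>z. f z * g z))"
    using germ_rel_mult[OF 1] by (intro holo_near_0_cpartial) (simp add: germ_rel_refl)
  moreover have "germ_rel (cpartial k f) (cpartial k f)" "germ_rel (cpartial k g) (cpartial k g)"
    using f g by (simp_all add: germ_rel_refl holo_near_0_cpartial)
  then have "germ_rel (\<lambda>z. cpartial k f z * g z + f z * cpartial k g z)
      (\<lambda>z. cpartial k f z * g z + f z * cpartial k g z)"
    using 1 by (intro germ_rel_add germ_rel_mult)
  moreover have "\<forall>\<^sub>F z in nhds 0. cpartial k (\<lambda>z. f z * g z) z =
      cpartial k f z * g z + f z * cpartial k g z"
    using f g unfolding holo_near_0_def by eventually_elim (rule cpartial_mult)
  ultimately show ?case by (simp add: germ_rel_def)
qed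

lemma germ_deriv_zero: "germ_deriv k 0 = 0"
  using germ_deriv_add[of k 0 0] by simp

lemma germ_deriv_sum: "germ_deriv k (\<Sum>i\<in>A. f i) = (\<Sum>i\<in>A. germ_deriv k (f i))"
  by (induction A rule: infinite_finite_induct) (simp_all add: germ_deriv_zero germ_deriv_add)

section \<open>Coordinate germs and the chain rule\<close>

lift_definition map_germ_nth :: "'n::finite map_germ \<Rightarrow> 'n \<Rightarrow> 'n germ" is "\<lambda>\<phi> i z. \<phi> z $ i"
proof -
  fix \<phi> \<psi> :: "complex ^ 'n \<Rightarrow> complex ^ 'n" and i
  assume *: "map_germ_rel \<phi> \<psi>"
  then have "\<forall>\<^sub>F z in nhds 0. \<phi> z = \<psi> z" by (simp add: map_germ_rel_def)
  then have "\<forall>\<^sub>F z in nhds 0. \<phi> z $ i = \<psi> z $ i" by eventually_elim simp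
  with * show "germ_rel (\<lambda>z. \<phi> z $ i) (\<lambda>z. \<psi> z $ i)"
    by (simp add: germ_rel_def map_germ_rel_def)
qed

text \<open>The derivative of the composition is computed once by \<open>diff_chain_at\<close> and
  once from its own partial derivatives. Uniqueness, evaluated at \<open>axis k 1\<close>, yields
  the formula.\<close>

lemma cpartial_compose:
  fixes \<phi> :: "complex ^ 'n \<Rightarrow> complex ^ 'm"
  assumes f: "cdiff f (\<phi> z)" and \<phi>: "\<And>i. cdiff (\<lambda>z. \<phi> z $ i) z"
  shows "cpartial k (\<lambda>z. f (\<phi> z)) z = (\<Sum>l\<in>UNIV. cpartial l f (\<phi> z) * cpartial k (\<lambda>z. \<phi> z $ l) z)"
proof -
  from vec_nth_cdiff_has_derivative[OF \<phi>] obtain D where D: "(\<phi> has_derivative D) (at z)" by blast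
  have D_nth: "D v $ l = (\<Sum>i\<in>UNIV. v $ i * cpartial i (\<lambda>z. \<phi> z $ l) z)" for v l
    by (rule has_derivative_unique[THEN fun_cong,
          OF bounded_linear.has_derivative[OF bounded_linear_vec_nth] cdiff_cpartial(2)[OF \<phi>]]) (rule D)
  have axis_sum: "(\<Sum>i\<in>UNIV. axis k 1 $ i * c i) = c k" for c :: "'n \<Rightarrow> complex"
    by (simp add: axis_def if_distrib[of "\<lambda>x. x * _"] cong: if_cong)
  have 1: "((\<lambda>z. f (\<phi> z)) has_derivative (\<lambda>v. \<Sum>l\<in>UNIV. D v $ l * cpartial l f (\<phi> z))) (at z)"
    using diff_chain_at[OF D cdiff_cpartial(2)[OF f]] by (simp add: o_def)
  have 2: "((\<lambda>z. f (\<phi> z)) has_derivative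
      (\<lambda>v. \<Sum>i\<in>UNIV. v $ i * cpartial i (\<lambda>z. f (\<phi> z)) z)) (at z)"
    by (rule cdiff_cpartial(2)[OF cdiff_compose[of f \<phi>, OF f \<phi>]])
  show ?thesis
    using fun_cong[OF has_derivative_unique[OF 2 1], of "axis k 1"]
    by (simp add: D_nth axis_sum mult.commute)
qed

section \<open>Pullback as a homomorphism of algebras\<close>

lemma germ_comp_add: "(f + g) \<circ>\<^sub>g \<phi> = f \<circ>\<^sub>g \<phi> + g \<circ>\<^sub>g \<phi>"
proof (transfer, goal_cases)
  case (1 f g \<phi>)
  then show ?case
    using holo_near_0_compose[of "\<lambda>z. f z + g z" \<phi>] germ_rel_add[OF 1(1,2)]
    by (auto simp: germ_rel_def map_germ_rel_def)
qed

lemma germ_comp_mult: "(f * g) \<circ>\<^sub>g \<phi> = (f \<circ>\<^sub>g \<phi>) * (g \<circ>\<^sub>g \<phi>)"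
proof (transfer, goal_cases)
  case (1 f g \<phi>)
  then show ?case
    using holo_near_0_compose[of "\<lambda>z. f z * g z" \<phi>] germ_rel_mult[OF 1(1,2)]
    by (auto simp: germ_rel_def map_germ_rel_def)
qed

lemma germ_comp_const: "germ_const c \<circ>\<^sub>g \<phi> = germ_const c"
  by transfer (rule germ_rel_const)

lemma germ_const_1: "germ_const 1 = 1"
  by transfer (rule germ_rel_const)

lemma germ_const_add: "germ_const (a + b) = germ_const a + germ_const b"
  by transfer (rule germ_rel_const)

lemma germ_comp_1: "1 \<circ>\<^sub>g \<phi> = 1"
  using germ_comp_const[of 1 \<phi>] by (simp add: germ_const_1)

lemma germ_comp_0: "0 \<circ>\<^sub>g \<phi> = 0"
  using germ_comp_add[of 0 0 \<phi>] by simp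

lemma germ_comp_minus: "(- f) \<circ>\<^sub>g \<phi> = - (f \<circ>\<^sub>g \<phi>)"
  using germ_comp_add[of f "- f" \<phi>] by (simp add: germ_comp_0 eq_neg_iff_add_eq_0 add.commute)

lemma germ_comp_sum: "(\<Sum>i\<in>A. f i) \<circ>\<^sub>g \<phi> = (\<Sum>i\<in>A. f i \<circ>\<^sub>g \<phi>)"
  by (induction A rule: infinite_finite_induct) (simp_all add: germ_comp_0 germ_comp_add)

lemma germ_comp_prod: "(\<Prod>i\<in>A. f i) \<circ>\<^sub>g \<phi> = (\<Prod>i\<in>A. f i \<circ>\<^sub>g \<phi>)"
  by (induction A rule: infinite_finite_induct) (simp_all add: germ_comp_1 germ_comp_mult)

lemma germ_comp_id: "f \<circ>\<^sub>g map_germ_id = f"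
  by transfer (simp add: germ_rel_def)

lemma germ_comp_comp: "f \<circ>\<^sub>g map_germ_comp \<phi> \<psi> = f \<circ>\<^sub>g \<phi> \<circ>\<^sub>g \<psi>"
proof (transfer, goal_cases)
  case (1 f \<phi> \<psi>)
  then have "holo_near_0 (\<lambda>z. f (\<phi> (\<psi> z)))"
    using holo_near_0_compose[OF holo_near_0_compose[of f \<phi>], of \<psi>]
    by (simp add: germ_rel_def map_germ_rel_def)
  then show ?case by (simp add: germ_rel_refl)
qed

lemma map_germ_nth_comp: "map_germ_nth \<phi> i \<circ>\<^sub>g \<psi> = map_germ_nth (map_germ_comp \<phi> \<psi>) i"
proof (transfer, goal_cases)
  case (1 \<phi> i \<psi>)
  then show ?case
    using holo_near_0_compose[of "\<lambda>z. \<phi> z $ i" \<psi>]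
    by (simp add: germ_rel_refl map_germ_rel_def)
qed

lemma germ_deriv_map_germ_id: "germ_deriv k (map_germ_nth map_germ_id i) = (if k = i then 1 else 0)"
proof -
  have "germ_deriv k (map_germ_nth map_germ_id i) = germ_const (if k = i then 1 else 0)"
  proof (transfer, goal_cases)
    case (1 k i)
    have "cpartial k (\<lambda>z. z $ i) z = (if k = i then 1 else 0)" for z :: "complex ^ 'a"
      unfolding cpartial_def
      by (rule DERIV_imp_deriv) (auto simp: axis_def intro!: derivative_eq_intros)
    then have "cpartial k (\<lambda>z. z $ i) = (\<lambda>_. if k = i then 1 else 0)" by blast
    then show ?case by (simp add: germ_rel_const)
  qed
  \<comment> \<open>The case \<open>k \<noteq> i\<close> needs \<open>germ_const 0 = 0\<close>,
    which additivity gives.\<close>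
  then show ?thesis by (simp add: germ_const_1) (metis add_cancel_right_left germ_const_add)
qed

text \<open>Lets the sum in the chain rule be formed on representatives. Holomorphy is proved in the
  same induction because \<open>plus_germ.abs_eq\<close> requires it of both summands.\<close>

lemma abs_germ_sum:
  assumes "\<And>i. i \<in> A \<Longrightarrow> holo_near_0 (f i)"
  shows "holo_near_0 (\<lambda>z. \<Sum>i\<in>A. f i z) \<and> abs_germ (\<lambda>z. \<Sum>i\<in>A. f i z) = (\<Sum>i\<in>A. abs_germ (f i))"
  using assms
proof (induction A rule: infinite_finite_induct)
  case (insert x A)
  then have "holo_near_0 (f x)" "holo_near_0 (\<lambda>z. \<Sum>i\<in>A. f i z)"
    "abs_germ (\<lambda>z. \<Sum>i\<in>A. f i z) = (\<Sum>i\<in>A. abs_germ (f i))" by auto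
  with insert.hyps show ?case
    using germ_rel_add[of "f x" "f x" "\<lambda>z. \<Sum>i\<in>A. f i z" "\<lambda>z. \<Sum>i\<in>A. f i z"]
      plus_germ.abs_eq[of "f x" "\<lambda>z. \<Sum>i\<in>A. f i z"]
    by (simp add: germ_rel_refl)
qed (simp_all add: zero_germ_def[symmetric] germ_rel_refl[symmetric] germ_rel_const)

lemma germ_deriv_comp:
  "germ_deriv k (f \<circ>\<^sub>g \<phi>) = (\<Sum>l\<in>UNIV. (germ_deriv l f \<circ>\<^sub>g \<phi>) * germ_deriv k (map_germ_nth \<phi> l))"
proof -
  obtain g where g: "germ_rel g g" "f = abs_germ g"
    using Quotient_germ unfolding Quotient_def by metis
  obtain p where p: "map_germ_rel p p" "\<phi> = abs_map_germ p"
    using Quotient_map_germ unfolding Quotient_def by metis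
  have hg: "holo_near_0 g" and p0: "p 0 = 0" and hp: "holo_near_0 (\<lambda>z. p z $ l)" for l
    using g p by (auto simp: germ_rel_def map_germ_rel_def)
  have rp: "germ_rel (\<lambda>z. p z $ l) (\<lambda>z. p z $ l)" for l by (simp add: germ_rel_refl hp)
  have hd: "germ_rel (cpartial l g) (cpartial l g)" for l
    by (simp add: germ_rel_refl holo_near_0_cpartial hg)
  have hdp: "germ_rel (\<lambda>z. cpartial l g (p z)) (\<lambda>z. cpartial l g (p z))" for l
    using hd[of l] p0 hp by (simp add: germ_rel_refl holo_near_0_compose)
  have hpd: "germ_rel (cpartial k (\<lambda>z. p z $ l)) (cpartial k (\<lambda>z. p z $ l))" for l
    by (simp add: germ_rel_refl holo_near_0_cpartial hp)
  have gp: "germ_rel (\<lambda>z. g (p z)) (\<lambda>z. g (p z))"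
    using hg p0 hp by (simp add: germ_rel_refl holo_near_0_compose)
  have 1: "germ_deriv k (f \<circ>\<^sub>g \<phi>) = abs_germ (cpartial k (\<lambda>z. g (p z)))"
    using g p gp by (simp add: germ_comp.abs_eq germ_deriv.abs_eq)
  have 2: "(germ_deriv l f \<circ>\<^sub>g \<phi>) * germ_deriv k (map_germ_nth \<phi> l) =
      abs_germ (\<lambda>z. cpartial l g (p z) * cpartial k (\<lambda>z. p z $ l) z)" for l
    using g p hd hdp hpd rp
    by (simp add: germ_comp.abs_eq germ_deriv.abs_eq map_germ_nth.abs_eq times_germ.abs_eq)
  have hm: "holo_near_0 (\<lambda>z. cpartial l g (p z) * cpartial k (\<lambda>z. p z $ l) z)" for l
    using germ_rel_mult[OF hdp hpd] by (simp add: germ_rel_refl)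
  \<comment> \<open>Since \<open>p\<close> tends to 0 at 0, the points \<open>p z\<close> stay where
    \<open>g\<close> is complex differentiable, so the pointwise chain rule applies near the
    origin.\<close>
  have ev: "\<forall>\<^sub>F z in nhds 0. cdiff g (p z)"
    using map_germ_tendsto[OF p0 hp] hg unfolding filterlim_iff holo_near_0_def by blast
  have evp: "\<forall>\<^sub>F z in nhds 0. \<forall>i. cdiff (\<lambda>z. p z $ i) z"
    using hp by (intro eventually_all_finite) (simp add: holo_near_0_def)
  from ev evp have "\<forall>\<^sub>F z in nhds 0. cpartial k (\<lambda>z. g (p z)) z =
      (\<Sum>l\<in>UNIV. cpartial l g (p z) * cpartial k (\<lambda>z. p z $ l) z)"
    by eventually_elim (rule cpartial_compose; simp)
  moreover have "holo_near_0 (cpartial k (\<lambda>z. g (p z)))"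
    using gp by (simp add: germ_rel_refl holo_near_0_cpartial)
  ultimately have "germ_rel (cpartial k (\<lambda>z. g (p z)))
      (\<lambda>z. \<Sum>l\<in>UNIV. cpartial l g (p z) * cpartial k (\<lambda>z. p z $ l) z)"
    using abs_germ_sum[of UNIV "\<lambda>l z. cpartial l g (p z) * cpartial k (\<lambda>z. p z $ l) z"] hm
    by (simp add: germ_rel_def)
  then have "abs_germ (cpartial k (\<lambda>z. g (p z))) =
      abs_germ (\<lambda>z. \<Sum>l\<in>UNIV. cpartial l g (p z) * cpartial k (\<lambda>z. p z $ l) z)"
    by (rule Quotient_rel_abs[OF Quotient_germ])
  with abs_germ_sum[of UNIV "\<lambda>l z. cpartial l g (p z) * cpartial k (\<lambda>z. p z $ l) z"] hm
  show ?thesis by (simp add: 1 2)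
qed

section \<open>Ideals and determinants\<close>

lemma ring_germ_algebra: "ring germ_algebra"
proof (rule ringI)
  show "abelian_group (germ_algebra :: (complex, 'n::finite germ) module)"
  proof (rule abelian_groupI)
    fix x :: "'n germ"
    show "\<exists>y\<in>carrier germ_algebra. y \<oplus>\<^bsub>germ_algebra\<^esub> x = \<zero>\<^bsub>germ_algebra\<^esub>"
      by (rule bexI[of _ "- x"]) (auto simp: germ_algebra_def)
  qed (auto simp: germ_algebra_def algebra_simps)
  show "Group.monoid (germ_algebra :: (complex, 'n::finite germ) module)"
    by (rule monoidI) (auto simp: germ_algebra_def algebra_simps)
qed (auto simp: germ_algebra_def algebra_simps)

interpretation germ_algebra: ring "germ_algebra :: (complex, 'n::finite germ) module"
  by (rule ring_germ_algebra)

lemma germ_algebra_simps [simp]: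
  "carrier germ_algebra = UNIV"
  "x \<oplus>\<^bsub>germ_algebra\<^esub> y = x + y"
  "x \<otimes>\<^bsub>germ_algebra\<^esub> y = x * y"
  "\<zero>\<^bsub>germ_algebra\<^esub> = 0"
  "\<one>\<^bsub>germ_algebra\<^esub> = 1"
  "c \<odot>\<^bsub>germ_algebra\<^esub> x = germ_const c * x"
  by (simp_all add: germ_algebra_def)

abbreviation germ_ideal :: "'n::finite germ set \<Rightarrow> bool" where
  "germ_ideal J \<equiv> ideal J (germ_algebra :: (complex, 'n germ) module)"

lemma germ_ideal_iff:
  fixes J :: "'n::finite germ set"
  shows "germ_ideal J \<longleftrightarrow> 0 \<in> J \<and> (\<forall>x\<in>J. \<forall>y\<in>J. x + y \<in> J) \<and> (\<forall>x\<in>J. \<forall>r. r * x \<in> J)"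
proof
  assume J: "germ_ideal J"
  interpret ideal J germ_algebra by (rule J)
  show "0 \<in> J \<and> (\<forall>x\<in>J. \<forall>y\<in>J. x + y \<in> J) \<and> (\<forall>x\<in>J. \<forall>r. r * x \<in> J)"
    using zero_closed a_closed I_l_closed by simp
next
  assume J: "0 \<in> J \<and> (\<forall>x\<in>J. \<forall>y\<in>J. x + y \<in> J) \<and> (\<forall>x\<in>J. \<forall>r. r * x \<in> J)"
  show "germ_ideal J"
  proof (rule idealI[OF ring_germ_algebra])
    have "- x \<in> J" if "x \<in> J" for x
      using J that by (metis mult_minus1)
    moreover have "\<ominus>\<^bsub>germ_algebra\<^esub> x = - x" for x :: "'n germ"
      by (rule germ_algebra.minus_equality) simp_all
    ultimately show "subgroup J (add_monoid germ_algebra)"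
      using J by (intro germ_algebra.add.subgroupI) (auto simp: a_inv_def)
  qed (use J in \<open>auto simp: mult.commute\<close>)
qed

lemma germ_ideal_sum: "germ_ideal J \<Longrightarrow> (\<And>i. i \<in> A \<Longrightarrow> f i \<in> J) \<Longrightarrow> sum f A \<in> J"
  by (induction A rule: infinite_finite_induct) (auto simp: germ_ideal_iff)

lemma germ_ideal_mult: "germ_ideal J \<Longrightarrow> x \<in> J \<Longrightarrow> r * x \<in> J"
  by (auto simp: germ_ideal_iff)

text \<open>Lets a sign or an invertible determinant be cancelled inside an ideal.\<close>

lemma germ_ideal_mult_unit:
  assumes "germ_ideal J" "a * b = 1"
  shows "b * x \<in> J \<longleftrightarrow> x \<in> J"
  using germ_ideal_mult[OF assms(1), of "b * x" a] germ_ideal_mult[OF assms(1), of x b] assms(2)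
  by (auto simp: mult.assoc[symmetric])

section \<open>Determinants modulo an ideal\<close>

text \<open>A determinant is a polynomial in its entries, so congruent entries give congruent
  determinants. Products of entries are compared one factor at a time.\<close>

lemma germ_ideal_det_cong:
  fixes A B :: "'m::finite \<Rightarrow> 'm \<Rightarrow> 'n::finite germ"
  assumes J: "germ_ideal J" and AB: "\<And>i j. A i j - B i j \<in> J" and B: "det (\<chi> i j. B i j) \<in> J"
  shows "det (\<chi> i j. A i j) \<in> J"
proof -
  have prod_cong: "(\<Prod>i\<in>I. A i (p i)) - (\<Prod>i\<in>I. B i (p i)) \<in> J" for I and p :: "'m \<Rightarrow> 'm"
  proof (induction I rule: infinite_finite_induct)
    case (insert x I)
    have "(\<Prod>i\<in>insert x I. A i (p i)) - (\<Prod>i\<in>insert x I. B i (p i)) =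
        A x (p x) * ((\<Prod>i\<in>I. A i (p i)) - (\<Prod>i\<in>I. B i (p i))) +
        (\<Prod>i\<in>I. B i (p i)) * (A x (p x) - B x (p x))"
      using insert.hyps by (simp add: algebra_simps)
    with insert.IH AB J show ?case by (simp add: germ_ideal_iff)
  qed (use J in \<open>simp_all add: germ_ideal_iff\<close>)
  have "det (\<chi> i j. A i j) - det (\<chi> i j. B i j) =
      (\<Sum>p | p permutes UNIV. of_int (sign p) * ((\<Prod>i\<in>UNIV. A i (p i)) - (\<Prod>i\<in>UNIV. B i (p i))))"
    by (simp add: det_def sum_subtractf right_diff_distrib)
  also have "\<dots> \<in> J"
    by (intro germ_ideal_sum[OF J] germ_ideal_mult[OF J] prod_cong)
  finally have "(det (\<chi> i j. A i j) - det (\<chi> i j. B i j)) + det (\<chi> i j. B i j) \<in> J"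
    using J B unfolding germ_ideal_iff by blast
  then show ?thesis by simp
qed

text \<open>The permutation acts on the row index, so each factor belongs to a fixed column
  \<open>p\<close> and column operations can be read off factor by factor.\<close>

lemma det_columns:
  fixes A :: "'m::finite \<Rightarrow> 'm \<Rightarrow> 'a::comm_ring_1"
  shows "det (\<chi> r p. A r p) = (\<Sum>\<pi> | \<pi> permutes UNIV. of_int (sign \<pi>) * (\<Prod>p\<in>UNIV. A (\<pi> p) p))"
  using det_transpose[of "\<chi> r p. A r p"] by (simp add: det_def transpose_def)

lemma det_scale_columns:
  fixes A :: "'m::finite \<Rightarrow> 'm \<Rightarrow> 'a::comm_ring_1"
  shows "det (\<chi> r p. w p * A r p) = prod w UNIV * det (\<chi> r p. A r p)"
  by (simp add: det_columns sum_distrib_left prod.distrib mult.left_commute)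

text \<open>As in the Cauchy-Binet formula, multilinearity in the columns writes the determinant of
  the product as a combination of determinants of columns of \<open>A\<close>. The choice
  \<open>s\<close> runs over all functions, repetitions included, which avoids ordering the
  columns.\<close>

lemma germ_ideal_det_column_comb:
  fixes A :: "'m::finite \<Rightarrow> 'c::finite \<Rightarrow> 'n::finite germ"
  assumes J: "germ_ideal J" and A: "\<And>s. det (\<chi> r p. A r (s p)) \<in> J"
  shows "det (\<chi> r p. \<Sum>c\<in>UNIV. A r c * Q c p) \<in> J"
proof -
  have "det (\<chi> r p. \<Sum>c\<in>UNIV. A r c * Q c p) =
      (\<Sum>\<pi> | \<pi> permutes UNIV. \<Sum>s\<in>UNIV. of_int (sign \<pi>) * (\<Prod>p\<in>UNIV. A (\<pi> p) (s p) * Q (s p) p))"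
    by (simp add: det_columns prod_sum_PiE sum_distrib_left)
  also have "\<dots> = (\<Sum>s\<in>UNIV. \<Sum>\<pi> | \<pi> permutes UNIV. of_int (sign \<pi>) * (\<Prod>p\<in>UNIV. A (\<pi> p) (s p) * Q (s p) p))"
    by (rule sum.swap)
  also have "\<dots> = (\<Sum>s\<in>UNIV. (\<Prod>p\<in>UNIV. Q (s p) p) * det (\<chi> r p. A r (s p)))"
    by (simp add: det_columns sum_distrib_left prod.distrib mult_ac)
  also have "\<dots> \<in> J"
    by (intro germ_ideal_sum[OF J] germ_ideal_mult[OF J] A)
  finally show ?thesis .
qed

text \<open>Used to bring an arbitrary selection of columns into increasing order. Position
  \<open>p\<close> receives the element whose key has the same rank among the keys as
  \<open>p\<close> has in its type.\<close>

lemma ex_permutation_sorting: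
  fixes s :: "'m::{finite,linorder} \<Rightarrow> 'd" and key :: "'d \<Rightarrow> nat"
  assumes inj: "inj (\<lambda>x. key (s x))"
  shows "\<exists>\<pi>. \<pi> permutes UNIV \<and> (\<forall>p q. p < q \<longrightarrow> key (s (\<pi> p)) < key (s (\<pi> q)))"
proof -
  let ?k = "\<lambda>x. key (s x)"
  have card: "card (range ?k) = card (UNIV :: 'm set)"
    by (rule card_image[OF inj])
  \<comment> \<open>\<open>h\<close> lists the key values in increasing order starting at index 0,
    which is why \<open>rank\<close> counts strictly smaller elements.\<close>
  obtain h where h: "bij_betw h {0..<card (UNIV :: 'm set)} (range ?k)"
      "strict_mono_on {0..<card (UNIV :: 'm set)} h"
    by (rule ex_bij_betw_strict_mono_card[of "range ?k", unfolded card])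
      (auto simp: atLeast0LessThan)
  define rank where "rank p = card {x. x < p}" for p :: 'm
  have rank: "rank p \<in> {0..<card (UNIV :: 'm set)}" for p
    unfolding rank_def using psubset_card_mono[of UNIV "{x. x < p}"] by auto
  have rank_mono: "rank p < rank q" if "p < q" for p q
    unfolding rank_def by (rule psubset_card_mono) (use that in auto)
  define \<pi> where "\<pi> p = inv_into UNIV ?k (h (rank p))" for p
  have key_\<pi>: "?k (\<pi> p) = h (rank p)" for p
  proof -
    have "h (rank p) \<in> range ?k"
      using rank h(1) unfolding bij_betw_def by blast
    then show ?thesis unfolding \<pi>_def by (rule f_inv_into_f)
  qed
  have mono: "?k (\<pi> p) < ?k (\<pi> q)" if "p < q" for p q
    unfolding key_\<pi> by (rule strict_mono_onD[OF h(2) rank rank rank_mono[OF that]])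
  have "inj \<pi>"
    by (rule injI) (metis mono linorder_neqE less_irrefl)
  then have "\<pi> permutes UNIV"
    by (intro bij_imp_permutes) (simp_all add: bij_def finite_UNIV_inj_surj)
  with mono show ?thesis by blast
qed

section \<open>The symmetrised second Jacobian matrix\<close>

text \<open>
  The columns are indexed by all pairs \<open>(i, j)\<close> with \<open>j \<noteq> 0\<close>, so that sums over columns need no
  order; the diagonal columns \<open>(i, i)\<close> are twice those of \<^const>\<open>jac2\<close>.
\<close>

fun jac2_sym :: "'n::finite germ \<Rightarrow> 'n option \<Rightarrow> 'n option \<times> 'n \<Rightarrow> 'n germ" where
  "jac2_sym F None (None, b) = germ_deriv b F"
| "jac2_sym F None (Some a, b) = germ_deriv a (germ_deriv b F)"
| "jac2_sym F (Some k) (None, b) = 0"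
| "jac2_sym F (Some k) (Some a, b) =
    (if k = a then germ_deriv b F else 0) + (if k = b then germ_deriv a F else 0)"

section \<open>Comparison with the second Jacobian matrix\<close>

lemma germ_const_half: "germ_const (1/2) * (2 * x) = x"
proof -
  have "germ_const (1/2) * (2 :: 'a germ) = 1"
    by (simp add: mult_2_right germ_const_1 flip: germ_const_add)
  then show ?thesis by (simp flip: mult.assoc)
qed

lemma jac2_eq_jac2_sym:
  "jac2 F r (i, Some j) = (if i = Some j then germ_const (1/2) else 1) * jac2_sym F r (i, j)"
  by (cases r; cases i) (auto simp: germ_const_half)

text \<open>For \<open>i\<close> above \<open>Some j\<close> the pair has to be swapped; in row
  \<open>None\<close> this is the symmetry of second derivatives.\<close>

lemma jac2_sym_eq_jac2:
  "jac2_sym F r (i, j) = (if i = Some j then 2 else 1) *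
    jac2 F r (if i \<le> Some j then (i, Some j) else (Some j, i))"
proof -
  have "2 * (germ_const (1/2) * x) = x" for x :: "'a germ"
    using germ_const_half[of x] by (simp add: mult.left_commute)
  then show ?thesis
    by (cases r; cases i) (auto simp: germ_deriv_commute)
qed

text \<open>Numbers the columns so that \<open>col_less\<close> becomes the order of the natural
  numbers, the form of key that \<open>ex_permutation_sorting\<close> takes.\<close>

definition col_rank :: "'n::{finite,linorder} option \<times> 'n option \<Rightarrow> nat" where
  "col_rank c = card {d. col_less d c}"

lemma col_rank_less:
  assumes "col_less c d"
  shows "col_rank c < col_rank d"
  unfolding col_rank_def using assms
  by (intro psubset_card_mono) (auto simp: col_less_def)

lemma col_rank_less_iff: "col_rank c < col_rank d \<longleftrightarrow> col_less c d"
proof -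
  have "c = d \<or> col_less c d \<or> col_less d c"
    unfolding col_less_def by (metis linorder_less_linear prod.expand)
  then show ?thesis using col_rank_less[of c d] col_rank_less[of d c] by auto
qed

lemma inj_col_rank: "inj col_rank"
proof (rule injI)
  fix c d :: "'a option \<times> 'a option"
  assume "col_rank c = col_rank d"
  then have "\<not> col_less c d" "\<not> col_less d c"
    by (simp_all flip: col_rank_less_iff)
  then show "c = d"
    unfolding col_less_def by (metis linorder_less_linear prod.expand)
qed

text \<open>Distinct columns can be sorted, which changes the determinant only by a sign and gives a
  maximal minor; a repeated column makes it vanish.\<close>

lemma jac2_det_in_ideal:
  assumes J: "germ_ideal J" "jac2_maximal_minors F \<subseteq> J" and t: "range t \<subseteq> jac2_cols"
  shows "det (\<chi> r p. jac2 F r (t p)) \<in> J"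
proof (cases "inj t")
  case True
  then have "inj (\<lambda>x. col_rank (t x))"
    using inj_compose[OF inj_col_rank] by (simp add: o_def)
  then obtain \<pi> where \<pi>: "\<pi> permutes UNIV" "\<And>p q. p < q \<Longrightarrow> col_less (t (\<pi> p)) (t (\<pi> q))"
    using ex_permutation_sorting[of col_rank t] by (auto simp: col_rank_less_iff)
  have "det (\<chi> r p. jac2 F r ((t \<circ> \<pi>) p)) \<in> jac2_maximal_minors F"
    unfolding jac2_maximal_minors_def using t \<pi>(2)
    by (intro CollectI exI[of _ "t \<circ> \<pi>"]) auto
  then have "of_int (sign \<pi>) * det (\<chi> r p. jac2 F r (t p)) \<in> J"
    using J(2) det_permute_columns[OF \<pi>(1), of "\<chi> r p. jac2 F r (t p)"] by auto
  moreover have "of_int (sign \<pi>) * of_int (sign \<pi>) = (1 :: 'a germ)"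
    by (simp flip: of_int_mult add: sign_def)
  ultimately show ?thesis by (metis germ_ideal_mult_unit[OF J(1)])
next
  case False
  then obtain p q where pq: "p \<noteq> q" "t p = t q" by (auto simp: inj_def)
  have "det (\<chi> r p. jac2 F r (t p)) = 0"
    by (rule det_identical_columns[OF pq(1)]) (simp add: column_def pq(2))
  with J(1) show ?thesis by (simp add: germ_ideal_iff)
qed

text \<open>Frees the minors from the order on the columns. Columns of the two matrices correspond
  up to swapping a pair and factors 2 or 1/2, which an ideal absorbs.\<close>

lemma jac2_maximal_minors_subset_iff:
  assumes J: "germ_ideal J"
  shows "jac2_maximal_minors F \<subseteq> J \<longleftrightarrow> (\<forall>s. det (\<chi> r p. jac2_sym F r (s p)) \<in> J)"
proof (intro iffI allI subsetI)
  fix s :: "'a option \<Rightarrow> 'a option \<times> 'a"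
  assume *: "jac2_maximal_minors F \<subseteq> J"
  define t where "t p = (case s p of (i, j) \<Rightarrow> if i \<le> Some j then (i, Some j) else (Some j, i))" for p
  define w where "w p = (case s p of (i, j) \<Rightarrow> if i = Some j then 2 else (1 :: 'a germ))" for p
  have "jac2_sym F r (s p) = w p * jac2 F r (t p)" for r p
    using jac2_sym_eq_jac2[of F r "fst (s p)" "snd (s p)"]
    by (simp add: t_def w_def split_beta)
  moreover have "range t \<subseteq> jac2_cols"
    by (auto simp: t_def jac2_cols_def split_beta)
  ultimately show "det (\<chi> r p. jac2_sym F r (s p)) \<in> J"
    using jac2_det_in_ideal[OF J *, of t] by (simp add: det_scale_columns germ_ideal_mult[OF J])
next
  fix x
  assume *: "\<forall>s. det (\<chi> r p. jac2_sym F r (s p)) \<in> J" and "x \<in> jac2_maximal_minors F"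
  then obtain s :: "'a option \<Rightarrow> 'a option \<times> 'a option"
    where x: "x = det (\<chi> r p. jac2 F r (s p))" and s: "range s \<subseteq> jac2_cols"
    unfolding jac2_maximal_minors_def by blast
  \<comment> \<open>\<open>the\<close> is harmless: a column in \<open>jac2_cols\<close> never has
    second label \<open>None\<close>, since only \<open>None\<close> is at most \<open>None\<close>
    and \<open>(None, None)\<close> is excluded.\<close>
  define t where "t p = (fst (s p), the (snd (s p)))" for p
  define w where "w p = (if fst (t p) = Some (snd (t p)) then germ_const (1/2) else (1 :: 'a germ))" for p
  have "jac2 F r (s p) = w p * jac2_sym F r (t p)" for r p
  proof -
    have "s p \<in> jac2_cols" using s by blast
    then have "s p = (fst (t p), Some (snd (t p)))"
      by (cases "s p"; cases "snd (s p)") (auto simp: t_def jac2_cols_def less_eq_option_def split: option.splits)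
    then show ?thesis using jac2_eq_jac2_sym[of F r "fst (t p)" "snd (t p)"] by (simp add: w_def)
  qed
  then show "x \<in> J"
    using * by (simp add: x det_scale_columns germ_ideal_mult[OF J])
qed

section \<open>Transformation under contact equivalence\<close>

text \<open>The denominator of \<open>nash_algebra2\<close>, named so that ideals can be compared
  before passing to quotients.\<close>

definition nash_ideal2 :: "'n::{finite,linorder} germ \<Rightarrow> 'n germ set" where
  "nash_ideal2 F = genideal germ_algebra (insert F (jacobian_ideal2 F))"

lemma germ_ideal_nash_ideal2: "germ_ideal (nash_ideal2 F)"
  unfolding nash_ideal2_def by (rule germ_algebra.genideal_ideal) simp

lemma nash_ideal2_subset_iff:
  assumes J: "germ_ideal J"
  shows "nash_ideal2 F \<subseteq> J \<longleftrightarrow> F \<in> J \<and> (\<forall>s. det (\<chi> r p. jac2_sym F r (s p)) \<in> J)"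
  unfolding nash_ideal2_def jacobian_ideal2_def
  by (simp add: germ_algebra.Idl_subset_ideal[OF J] jac2_maximal_minors_subset_iff[OF J])

lemma sum_option_UNIV: "(\<Sum>i\<in>UNIV. f i) = f None + (\<Sum>i\<in>UNIV. f (Some i))"
  for f :: "'n::finite option \<Rightarrow> 'a::comm_monoid_add"
  by (simp add: UNIV_option_conv sum.reindex)

lemma sum_option_prod_UNIV:
  "(\<Sum>c\<in>UNIV. f c) = (\<Sum>j\<in>UNIV. f (None, j)) + (\<Sum>i\<in>UNIV. \<Sum>j\<in>UNIV. f (Some i, j))"
  for f :: "'n::finite option \<times> 'm::finite \<Rightarrow> 'a::comm_monoid_add"
  unfolding UNIV_Times_UNIV[symmetric] sum.cartesian_product' sum_option_UNIV ..

lemma if_distrib_mult: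
  "(if P then x else 0) * y = (if P then x * y else (0::'a::semiring_1))"
  "y * (if P then x else 0) = (if P then y * x else (0::'a))"
  by simp_all

section \<open>Multiplication by a germ\<close>

text \<open>Modulo \<open>F\<close>, the matrix of \<open>u * F\<close> is \<open>P\<close> times
  the matrix of \<open>F\<close>, so its minors are congruent to \<open>det P\<close> times those of
  \<open>F\<close>.\<close>

lemma nash_ideal2_mult_subset: "nash_ideal2 (u * F) \<subseteq> nash_ideal2 F"
proof -
  let ?J = "nash_ideal2 F"
  note J = germ_ideal_nash_ideal2[of F]
  have F: "F \<in> ?J" and minors: "det (\<chi> r p. jac2_sym F r (s p)) \<in> ?J" for s
    using nash_ideal2_subset_iff[OF J, of F] by simp_all
  \<comment> \<open>\<open>P\<close> is multiplication by \<open>u + \<delta>u\<close> modulo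
    \<open>(x)^2\<close> on the basis \<open>1, x_1, ..., x_n\<close>. Higher terms of
    \<open>\<delta>u\<close> drop out because \<open>\<delta>F\<close> has no constant term.\<close>
  define P :: "'a option \<Rightarrow> 'a option \<Rightarrow> 'a germ" where
    "P r q = (case (r, q) of (None, None) \<Rightarrow> u | (None, Some k) \<Rightarrow> germ_deriv k u
      | (Some k, Some l) \<Rightarrow> (if k = l then u else 0) | _ \<Rightarrow> 0)" for r q
  have entry: "jac2_sym (u * F) r c - (\<Sum>q\<in>UNIV. P r q * jac2_sym F q c) \<in> ?J" for r c
  proof -
    \<comment> \<open>The witness is in every case the entry \<open>jac2_sym u r c\<close>.\<close>
    have "\<exists>x. jac2_sym (u * F) r c - (\<Sum>q\<in>UNIV. P r q * jac2_sym F q c) = x * F"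
    proof (cases r; cases c; cases "fst c")
      fix i b assume "r = None" "c = (i, b)" "fst c = None"
      then show ?thesis
        by (intro exI[of _ "germ_deriv b u"])
          (simp add: P_def sum_option_UNIV germ_deriv_mult algebra_simps)
    next
      fix i b a assume "r = None" "c = (i, b)" "fst c = Some a"
      then show ?thesis
        by (intro exI[of _ "germ_deriv a (germ_deriv b u)"])
          (simp add: P_def sum_option_UNIV germ_deriv_mult germ_deriv_add algebra_simps
            if_distrib_mult sum.distrib)
    next
      fix k i b assume "r = Some k" "c = (i, b)" "fst c = None"
      then show ?thesis
        by (intro exI[of _ 0]) (simp add: P_def sum_option_UNIV)
    next
      fix k i b a assume "r = Some k" "c = (i, b)" "fst c = Some a"
      then show ?thesis
        by (intro exI[of _ "(if k = a then germ_deriv b u else 0) + (if k = b then germ_deriv a u else 0)"])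
          (simp add: P_def sum_option_UNIV germ_deriv_mult algebra_simps if_distrib_mult sum.distrib)
    qed
    with germ_ideal_mult[OF J F] show ?thesis by auto
  qed
  have "det (\<chi> r p. jac2_sym (u * F) r (s p)) \<in> ?J" for s
  proof (rule germ_ideal_det_cong[OF J entry])
    have "(\<chi> r p. \<Sum>q\<in>UNIV. P r q * jac2_sym F q (s p)) =
        (\<chi> r q. P r q) ** (\<chi> r p. jac2_sym F r (s p))"
      by (simp add: matrix_matrix_mult_def)
    then show "det (\<chi> r p. \<Sum>q\<in>UNIV. P r q * jac2_sym F q (s p)) \<in> ?J"
      by (simp add: det_mul germ_ideal_mult[OF J minors])
  qed
  then show ?thesis
    using germ_ideal_mult[OF J F] by (simp add: nash_ideal2_subset_iff[OF J])
qed

text \<open>The inclusion for \<open>u\<close>, and the one for its inverse applied to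
  \<open>u * F\<close>, together give equality.\<close>

lemma nash_ideal2_mult_unit:
  assumes "u dvd 1"
  shows "nash_ideal2 (u * F) = nash_ideal2 F"
proof -
  from assms obtain v where "v * u = 1" by (metis dvdE mult.commute)
  then have "nash_ideal2 (v * (u * F)) = nash_ideal2 F" by (simp flip: mult.assoc)
  then show ?thesis using nash_ideal2_mult_subset by blast
qed

section \<open>Composition with a biholomorphic germ\<close>

text \<open>The chain rule for the identity: the pulled back Jacobian matrix of
  \<open>\<psi>\<close> is inverse to that of \<open>\<phi>\<close>.\<close>

lemma map_germ_deriv_inverse:
  assumes "map_germ_comp \<psi> \<phi> = map_germ_id"
  shows "(\<Sum>l\<in>UNIV. (germ_deriv l (map_germ_nth \<psi> i) \<circ>\<^sub>g \<phi>) * germ_deriv k (map_germ_nth \<phi> l)) =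
    (if k = i then 1 else 0)"
  using germ_deriv_comp[of k "map_germ_nth \<psi> i" \<phi>]
  by (simp add: map_germ_nth_comp assms germ_deriv_map_germ_id)

lemma germ_comp_det: "det (\<chi> r p. A r p) \<circ>\<^sub>g \<phi> = det (\<chi> r p. A r p \<circ>\<^sub>g \<phi>)"
proof -
  have "of_int (sign \<pi>) \<circ>\<^sub>g \<phi> = of_int (sign \<pi>)" for \<pi> :: "'b \<Rightarrow> 'b"
    by (simp add: sign_def germ_comp_1 germ_comp_minus)
  then show ?thesis by (simp add: det_def germ_comp_sum germ_comp_mult germ_comp_prod)
qed

text \<open>Surjectivity makes the image absorb multiplication: every multiplier is itself a
  pullback.\<close>

lemma germ_ideal_comp_image:
  assumes J: "germ_ideal J" and \<phi>: "surj (\<lambda>f. f \<circ>\<^sub>g \<phi>)"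
  shows "germ_ideal ((\<lambda>f. f \<circ>\<^sub>g \<phi>) ` J)"
  unfolding germ_ideal_iff
proof (intro conjI ballI allI)
  let ?c = "\<lambda>f. f \<circ>\<^sub>g \<phi>"
  show "0 \<in> ?c ` J"
    using J by (intro image_eqI[of _ _ 0]) (simp_all add: germ_comp_0 germ_ideal_iff)
  fix x assume "x \<in> ?c ` J"
  then obtain x' where x': "x' \<in> J" "x = ?c x'" by blast
  show "x + y \<in> ?c ` J" if "y \<in> ?c ` J" for y
    using J that x' by (auto simp: germ_ideal_iff simp flip: germ_comp_add)
  show "r * x \<in> ?c ` J" for r
    using J x' surjD[OF \<phi>, of r] by (auto simp: germ_ideal_iff simp flip: germ_comp_mult)
qed

text \<open>\<open>R\<close> times the matrix of \<open>F \<circ>\<^sub>g \<phi>\<close> equals the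
  pulled back matrix of \<open>F\<close> times \<open>Q\<close>. Column combinations keep the minors
  in the ideal, and \<open>det R\<close> is a unit.\<close>

lemma nash_ideal2_comp_subset:
  assumes id: "map_germ_comp \<phi> \<psi> = map_germ_id" "map_germ_comp \<psi> \<phi> = map_germ_id"
  shows "nash_ideal2 (F \<circ>\<^sub>g \<phi>) \<subseteq> (\<lambda>f. f \<circ>\<^sub>g \<phi>) ` nash_ideal2 F"
proof -
  let ?J = "(\<lambda>f. f \<circ>\<^sub>g \<phi>) ` nash_ideal2 F"
  have "surj (\<lambda>f. f \<circ>\<^sub>g \<phi>)"
    by (rule surjI[of _ "\<lambda>f. f \<circ>\<^sub>g \<psi>"]) (simp add: germ_comp_comp[symmetric] id germ_comp_id)
  then have J: "germ_ideal ?J"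
    by (rule germ_ideal_comp_image[OF germ_ideal_nash_ideal2])
  have F: "F \<in> nash_ideal2 F" and minors: "det (\<chi> r p. jac2_sym F r (s p)) \<in> nash_ideal2 F" for s
    using nash_ideal2_subset_iff[OF germ_ideal_nash_ideal2, of F F] by simp_all
  define f where "f l = map_germ_nth \<phi> l" for l
  \<comment> \<open>Substituting \<open>\<delta>\<phi>\<close> for \<open>x\<close> turns the row
    \<open>x_l \<delta>F\<close> into \<open>\<delta>\<phi>_l\<close> times
    \<open>\<delta>(F \<circ> \<phi>)\<close>, and modulo \<open>(x)^3\<close> only the linear part
    of \<open>\<delta>\<phi>_l\<close> counts. Hence the Jacobian matrix in \<open>R\<close>;
    \<open>S\<close> is the inverse.\<close>
  define R :: "'a option \<Rightarrow> 'a option \<Rightarrow> 'a germ" where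
    "R r q = (case (r, q) of (None, None) \<Rightarrow> 1 | (Some l, Some k) \<Rightarrow> germ_deriv k (f l) | _ \<Rightarrow> 0)" for r q
  define S :: "'a option \<Rightarrow> 'a option \<Rightarrow> 'a germ" where
    "S r q = (case (r, q) of (None, None) \<Rightarrow> 1
      | (Some i, Some l) \<Rightarrow> germ_deriv l (map_germ_nth \<psi> i) \<circ>\<^sub>g \<phi> | _ \<Rightarrow> 0)" for r q
  \<comment> \<open>\<open>Q\<close> is the substitution on polynomials modulo \<open>(x)^3\<close>:
    \<open>x_l\<close> goes to the linear and quadratic parts of \<open>\<delta>\<phi>_l\<close>,
    and \<open>x_i x_j\<close> to a product of linear parts. Quadratic parts are recorded by their
    Hessian matrices, so no factor 1/2 appears.\<close>
  define Q :: "'a option \<times> 'a \<Rightarrow> 'a option \<times> 'a \<Rightarrow> 'a germ" where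
    "Q d c = (case (d, c) of ((None, l), (None, b)) \<Rightarrow> germ_deriv b (f l)
      | ((None, l), (Some a, b)) \<Rightarrow> germ_deriv a (germ_deriv b (f l))
      | ((Some i, j), (Some a, b)) \<Rightarrow> germ_deriv a (f i) * germ_deriv b (f j)
      | _ \<Rightarrow> 0)" for d c
  have D: "germ_deriv k (g \<circ>\<^sub>g \<phi>) = (\<Sum>l\<in>UNIV. (germ_deriv l g \<circ>\<^sub>g \<phi>) * germ_deriv k (f l))" for k g
    unfolding f_def by (rule germ_deriv_comp)
  have "(\<chi> r q. S r q) ** (\<chi> r q. R r q) = mat 1"
  proof -
    have "(\<Sum>q\<in>UNIV. S r q * R q p) = (if r = p then 1 else 0)" for r p
      using map_germ_deriv_inverse[OF id(2)]
      by (cases r; cases p) (auto simp: sum_option_UNIV S_def R_def f_def)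
    then show ?thesis by (simp add: matrix_matrix_mult_def mat_def vec_eq_iff)
  qed
  then have det_SR: "det (\<chi> r q. S r q) * det (\<chi> r q. R r q) = 1"
    by (metis det_mul det_I)
  have entry: "(\<Sum>q\<in>UNIV. R r q * jac2_sym (F \<circ>\<^sub>g \<phi>) q c) =
      (\<Sum>d\<in>UNIV. (jac2_sym F r d \<circ>\<^sub>g \<phi>) * Q d c)" for r c
  proof (cases r; cases c; cases "fst c")
    fix i b assume "r = None" "c = (i, b)" "fst c = None"
    then show ?thesis
      by (simp add: sum_option_UNIV sum_option_prod_UNIV R_def Q_def D)
  next
    fix i b a assume "r = None" "c = (i, b)" "fst c = Some a"
    \<comment> \<open>The second order chain rule, from two applications of \<open>D\<close> and the
      product rule.\<close>
    moreover have "germ_deriv a (germ_deriv b (F \<circ>\<^sub>g \<phi>)) =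
        (\<Sum>j\<in>UNIV. (germ_deriv j F \<circ>\<^sub>g \<phi>) * germ_deriv a (germ_deriv b (f j))) +
        (\<Sum>j\<in>UNIV. \<Sum>i\<in>UNIV. (germ_deriv i (germ_deriv j F) \<circ>\<^sub>g \<phi>) * (germ_deriv a (f i) * germ_deriv b (f j)))"
      by (simp add: D germ_deriv_sum germ_deriv_mult sum.distrib sum_distrib_right mult.assoc add.commute)
    ultimately show ?thesis
      by (simp add: sum_option_UNIV sum_option_prod_UNIV R_def Q_def)
        (subst sum.swap, simp)
  next
    fix k i b assume "r = Some k" "c = (i, b)" "fst c = None"
    then show ?thesis
      by (simp add: sum_option_UNIV sum_option_prod_UNIV R_def Q_def germ_comp_0)
  next
    fix l i b a assume rc: "r = Some l" "c = (i, b)" "fst c = Some a"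
    have "(\<Sum>q\<in>UNIV. R r q * jac2_sym (F \<circ>\<^sub>g \<phi>) q c) =
        germ_deriv a (f l) * germ_deriv b (F \<circ>\<^sub>g \<phi>) + germ_deriv b (f l) * germ_deriv a (F \<circ>\<^sub>g \<phi>)"
      using rc by (simp add: sum_option_UNIV R_def distrib_left sum.distrib if_distrib_mult)
    also have "\<dots> = (\<Sum>j\<in>UNIV. (germ_deriv j F \<circ>\<^sub>g \<phi>) * (germ_deriv a (f l) * germ_deriv b (f j))) +
        (\<Sum>i\<in>UNIV. (germ_deriv i F \<circ>\<^sub>g \<phi>) * (germ_deriv a (f i) * germ_deriv b (f l)))"
      by (simp add: D sum_distrib_left mult_ac)
    also have "\<dots> = (\<Sum>d\<in>UNIV. (jac2_sym F r d \<circ>\<^sub>g \<phi>) * Q d c)"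
    proof -
      \<comment> \<open>The conditionals are Kronecker deltas; moving them out of the pullback and
        the sums lets the sums collapse.\<close>
      have *: "(if P then x else 0) \<circ>\<^sub>g \<phi> = (if P then x \<circ>\<^sub>g \<phi> else 0)" for P x
        by (simp add: germ_comp_0)
      have **: "(\<Sum>j\<in>UNIV. if P then h j else 0) = (if P then sum h UNIV else 0)"
        for P and h :: "'a \<Rightarrow> 'a germ" by simp
      show ?thesis
        using rc by (simp add: sum_option_prod_UNIV Q_def germ_comp_0 germ_comp_add * distrib_right
            sum.distrib if_distrib_mult **)
    qed
    finally show ?thesis .
  qed
  have "det (\<chi> r p. jac2_sym (F \<circ>\<^sub>g \<phi>) r (s p)) \<in> ?J" for s
  proof -
    have "det (\<chi> r p. jac2_sym F r (t p) \<circ>\<^sub>g \<phi>) \<in> ?J" for t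
      using minors[of t] by (simp flip: germ_comp_det)
    then have "det (\<chi> r p. \<Sum>d\<in>UNIV. (jac2_sym F r d \<circ>\<^sub>g \<phi>) * Q d (s p)) \<in> ?J"
      by (rule germ_ideal_det_column_comb[OF J])
    moreover have "(\<chi> r p. \<Sum>d\<in>UNIV. (jac2_sym F r d \<circ>\<^sub>g \<phi>) * Q d (s p)) =
        (\<chi> r q. R r q) ** (\<chi> r p. jac2_sym (F \<circ>\<^sub>g \<phi>) r (s p))"
      by (simp add: matrix_matrix_mult_def entry)
    ultimately have "det (\<chi> r q. R r q) * det (\<chi> r p. jac2_sym (F \<circ>\<^sub>g \<phi>) r (s p)) \<in> ?J"
      by (simp add: det_mul)
    then show ?thesis using germ_ideal_mult_unit[OF J det_SR] by blast
  qed
  with F show ?thesis by (simp add: nash_ideal2_subset_iff[OF J])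
qed

lemma nash_ideal2_comp:
  assumes id: "map_germ_comp \<phi> \<psi> = map_germ_id" "map_germ_comp \<psi> \<phi> = map_germ_id"
  shows "nash_ideal2 (F \<circ>\<^sub>g \<phi>) = (\<lambda>f. f \<circ>\<^sub>g \<phi>) ` nash_ideal2 F"
proof
  show "nash_ideal2 (F \<circ>\<^sub>g \<phi>) \<subseteq> (\<lambda>f. f \<circ>\<^sub>g \<phi>) ` nash_ideal2 F"
    by (rule nash_ideal2_comp_subset[OF id])
  \<comment> \<open>The opposite inclusion is the same result for \<open>\<psi>\<close> and
    \<open>F \<circ>\<^sub>g \<phi>\<close>, carried back by \<open>\<phi>\<close>.\<close>
  have "nash_ideal2 F \<subseteq> (\<lambda>f. f \<circ>\<^sub>g \<psi>) ` nash_ideal2 (F \<circ>\<^sub>g \<phi>)"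
    using nash_ideal2_comp_subset[OF id(2,1), of "F \<circ>\<^sub>g \<phi>"]
    by (simp add: germ_comp_comp[symmetric] id germ_comp_id)
  then have "(\<lambda>f. f \<circ>\<^sub>g \<phi>) ` nash_ideal2 F \<subseteq> (\<lambda>f. f \<circ>\<^sub>g \<phi>) ` (\<lambda>f. f \<circ>\<^sub>g \<psi>) ` nash_ideal2 (F \<circ>\<^sub>g \<phi>)"
    by (rule image_mono)
  also have "\<dots> = nash_ideal2 (F \<circ>\<^sub>g \<phi>)"
    by (simp add: image_image germ_comp_comp[symmetric] id germ_comp_id)
  finally show "(\<lambda>f. f \<circ>\<^sub>g \<phi>) ` nash_ideal2 F \<subseteq> nash_ideal2 (F \<circ>\<^sub>g \<phi>)" .
qed

section \<open>Passage to the quotient algebras\<close>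

text \<open>Pullback by \<open>\<phi>\<close> is an algebra automorphism with inverse the pullback
  by \<open>\<psi>\<close>. Cosets are sets of germs, so the induced map on quotients takes the
  image of a coset.\<close>

lemma quotient_algebra_comp_iso:
  assumes J: "germ_ideal J"
    and id: "map_germ_comp \<phi> \<psi> = map_germ_id" "map_germ_comp \<psi> \<phi> = map_germ_id"
  shows "algebras_isomorphic (quotient_algebra germ_algebra J)
    (quotient_algebra germ_algebra ((\<lambda>f. f \<circ>\<^sub>g \<phi>) ` J))"
proof -
  define c where "c f = f \<circ>\<^sub>g \<phi>" for f
  have c\<psi>: "c (f \<circ>\<^sub>g \<psi>) = f" "c f \<circ>\<^sub>g \<psi> = f" for f
    by (simp_all add: c_def germ_comp_comp[symmetric] id germ_comp_id)
  have surj: "surj c" by (rule surjI[of _ "\<lambda>f. f \<circ>\<^sub>g \<psi>"]) (rule c\<psi>)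
  have inj: "inj c" by (rule inj_on_inverseI[of _ "\<lambda>f. f \<circ>\<^sub>g \<psi>"]) (rule c\<psi>)
  have J': "germ_ideal (c ` J)"
    using germ_ideal_comp_image[OF J] surj by (simp add: c_def)
  interpret J: ideal J germ_algebra by (rule J)
  interpret J': ideal "c ` J" germ_algebra by (rule J')
  let ?A = "germ_algebra :: (complex, 'a germ) module"
  have coset: "c ` (J +>\<^bsub>?A\<^esub> x) = c ` J +>\<^bsub>?A\<^esub> c x" for x
    by (simp add: a_r_coset_def' image_UN c_def germ_comp_add)
  have carrier: "carrier (quotient_algebra ?A I) = range (\<lambda>x. I +>\<^bsub>?A\<^esub> x)" for I
    by (auto simp: quotient_algebra_def FactRing_def A_RCOSETS_def' a_r_coset_def' ring.defs module.defs)
  have ops: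
    "\<one>\<^bsub>quotient_algebra ?A I\<^esub> = I +>\<^bsub>?A\<^esub> 1"
    "X \<oplus>\<^bsub>quotient_algebra ?A I\<^esub> Y = X <+>\<^bsub>?A\<^esub> Y"
    "X \<otimes>\<^bsub>quotient_algebra ?A I\<^esub> Y = [mod I:] X \<Otimes>\<^bsub>?A\<^esub> Y"
    "a \<odot>\<^bsub>quotient_algebra ?A I\<^esub> X = (\<Union>x\<in>X. I +>\<^bsub>?A\<^esub> (germ_const a * x))" for I X Y a
    by (simp_all add: quotient_algebra_def FactRing_def ring.defs module.defs)
  have "(`) c \<in> algebra_iso (quotient_algebra ?A J) (quotient_algebra ?A (c ` J))"
    unfolding algebra_iso_def ring_iso_def
  proof (intro CollectI conjI ballI allI ring_hom_memI)
    fix X assume "X \<in> carrier (quotient_algebra ?A J)"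
    then obtain x where X: "X = J +>\<^bsub>?A\<^esub> x" by (auto simp: carrier)
    show "c ` X \<in> carrier (quotient_algebra ?A (c ` J))"
      by (simp add: X coset carrier)
    \<comment> \<open>A scalar multiple of a coset is a union over its elements, and taking images
      commutes with this union.\<close>
    show "c ` (a \<odot>\<^bsub>quotient_algebra ?A J\<^esub> X) = a \<odot>\<^bsub>quotient_algebra ?A (c ` J)\<^esub> (c ` X)" for a
      by (simp add: ops image_UN coset) (simp add: c_def germ_comp_mult germ_comp_const)
    fix Y assume "Y \<in> carrier (quotient_algebra ?A J)"
    then obtain y where Y: "Y = J +>\<^bsub>?A\<^esub> y" by (auto simp: carrier)
    show "c ` (X \<otimes>\<^bsub>quotient_algebra ?A J\<^esub> Y) =
        c ` X \<otimes>\<^bsub>quotient_algebra ?A (c ` J)\<^esub> c ` Y"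
      by (simp add: X Y ops coset J.rcoset_mult_add J'.rcoset_mult_add)
        (simp add: c_def germ_comp_mult)
    show "c ` (X \<oplus>\<^bsub>quotient_algebra ?A J\<^esub> Y) =
        c ` X \<oplus>\<^bsub>quotient_algebra ?A (c ` J)\<^esub> c ` Y"
      by (simp add: X Y ops coset J.a_rcos_sum J'.a_rcos_sum) (simp add: c_def germ_comp_add)
  next
    show "c ` \<one>\<^bsub>quotient_algebra ?A J\<^esub> = \<one>\<^bsub>quotient_algebra ?A (c ` J)\<^esub>"
      by (simp add: ops coset) (simp add: c_def germ_comp_1)
    show "bij_betw ((`) c) (carrier (quotient_algebra ?A J)) (carrier (quotient_algebra ?A (c ` J)))"
      unfolding bij_betw_def
    proof
      show "inj_on ((`) c) (carrier (quotient_algebra ?A J))"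
        by (rule inj_onI) (simp add: inj_image_eq_iff[OF inj])
      have "(`) c ` range (\<lambda>x. J +>\<^bsub>?A\<^esub> x) = (\<lambda>y. c ` J +>\<^bsub>?A\<^esub> y) ` range c"
        by (simp add: image_image coset)
      then show "(`) c ` carrier (quotient_algebra ?A J) = carrier (quotient_algebra ?A (c ` J))"
        by (simp add: carrier surj)
    qed
  qed
  then show ?thesis
    unfolding algebras_isomorphic_def c_def by blast
qed

theorem theorem5p2:
  fixes F G u :: "'n::{finite,linorder} germ" and \<phi> :: "'n map_germ"
  assumes "isolated_singularity F"
    and "u dvd 1"
    and "biholomorphic_germ \<phi>"
    and "G = u * (F \<circ>\<^sub>g \<phi>)"
  shows "algebras_isomorphic (nash_algebra2 F) (nash_algebra2 G)"
proof -
  from assms(3) obtain \<psi> where id: "map_germ_comp \<phi> \<psi> = map_germ_id" "map_germ_comp \<psi> \<phi> = map_germ_id"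
    unfolding biholomorphic_germ_def by blast
  \<comment> \<open>The unit factor leaves the ideal unchanged, and composition carries it along by
    pullback.\<close>
  have "nash_ideal2 G = (\<lambda>f. f \<circ>\<^sub>g \<phi>) ` nash_ideal2 F"
    by (simp add: assms(4) nash_ideal2_mult_unit[OF assms(2)] nash_ideal2_comp[OF id])
  then show ?thesis
    using quotient_algebra_comp_iso[OF germ_ideal_nash_ideal2 id]
    by (simp add: nash_algebra2_def flip: nash_ideal2_def)
qed

end
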